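(* Assume that for every $\theta\in\Theta$, $Q_\theta=(q_{ij}(\theta))_{1\le i,j\le N}$ is a real matrix with $q_{ij}(\theta)\ge0$ for $i\neq j$ and $q_{ii}(\theta)=-\sum_{j\ne i}q_{ij}(\theta)$; that there exists $L_Q>0$ with $\|Q_\theta^*-Q_{\bar\theta}^*\|_{1\to1}\le L_Q|\theta-\bar\theta|$ for all $\theta,\bar\theta\in\Theta$; and that there exist $C_{\mathrm{mix}}\ge1$ and $\gamma>0$ such that $|e^{tQ_\theta^*}\xi|_1\le C_{\mathrm{mix}}e^{-\gamma t}|\xi|_1$ for all $\theta\in\Theta$, $\xi\in\mathcal{Z}$, $t\ge0$. For $\theta\in\Theta$ let $\mu_\theta$ be the unique element of $\Delta_S$ with $Q_\theta^*\mu_\theta=0$. Consider the reduced invariant-law system $$\dot{\bar\theta}=G(\bar\theta,\bar w,\mu_{\bar\theta}),\qquad \dot{\bar w}=b(\bar\theta,\mu_{\bar\theta})-A(\bar\theta,\mu_{\bar\theta})\bar w$$ on $Y:=\Theta\times\mathbb{R}^m$. Its vector field is locally Lipschitz on $Y$, it generates a continuous semiflow $\bar S(t)$, $t\ge0$, on $Y$, and the set $$K_Y:=\Theta\times\overline{B_{R_w}(0)}$$ is compact, forward invariant, and absorbing for $\bar S(t)$. Hence $\bar S(t)$ possesses a compact global attractor $\mathcal{A}_0=\omega(K_Y)$. Its lift $$\widehat{\mathcal{A}}_0:=\{(\theta,w,\mu_\theta)\in X:(\theta,w)\in\mathcal{A}_0\}$$ is compact, and the lifted reduced semiflow on $X=\Theta\times\mathbb{R}^m\times\Delta_S$,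 $$\Gamma_0(t)(\theta_0,w_0,\mu_0):=\bigl(\bar\theta(t),\bar w(t),\mu_{\bar\theta(t)}\bigr),\qquad (\bar\theta(t),\bar w(t))=\bar S(t)(\theta_0,w_0),$$ has global attractor $\widehat{\mathcal{A}}_0$.
   Context: Fix integers $N,K_0,d,m\ge1$ (number of states, number of actions, actor dimension, critic dimension) and positive constants $R_\theta,\tau,\lambda_c$. Below, $i$ ranges over $\{1,\dots,N\}$ and $a,b$ over $\{1,\dots,K_0\}$ when used as action indices. Fix data $r_{i,a}\in\mathbb{R}$, $\psi_{i,a}\in\mathbb{R}^d$, $\varphi_{i,a}\in\mathbb{R}^m$. Let $$\Theta=[-R_\theta,R_\theta]^d,\qquad \Delta_S=\Bigl\{\mu\in[0,\infty)^N:\sum_i\mu_i=1\Bigr\},\qquad \mathcal{Z}=\Bigl\{\xi\in\mathbb{R}^N:\sum_i\xi_i=0\Bigr\}.$$ Here $R_\theta$ is a constant (the subscript is part of its name). Define $$\pi_\theta(a\mid i)=\frac{\exp(\psi_{i,a}\cdot\theta/\tau)}{\sum_{b=1}^{K_0}\exp(\psi_{i,b}\cdot\theta/\tau)},\qquad \nu_{\theta,\mu}(i,a)=\mu_i\,\pi_\theta(a\mid i),$$ $$b(\theta,\mu)=\sum_{i,a}\nu_{\theta,\mu}(i,a)\,r_{i,a}\,\varphi_{i,a}\in\mathbb{R}^m,\qquad A(\theta,\mu)=\lambda_c I_m+\sum_{i,a}\nu_{\theta,\mu}(i,a)\,\varphi_{i,a}\varphi_{i,a}^\top,$$ $$\widetilde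 G(\theta,w,\mu)=\sum_{i,a}\nu_{\theta,\mu}(i,a)\bigl(r_{i,a}+\varphi_{i,a}\cdot w-\tau\log\pi_\theta(a\mid i)\bigr)\nabla_\theta\log\pi_\theta(a\mid i)\in\mathbb{R}^d,$$ $$D(\theta)=\operatorname{diag}(R_\theta^2-\theta_1^2,\dots,R_\theta^2-\theta_d^2),\qquad G(\theta,w,\mu)=D(\theta)\widetilde G(\theta,w,\mu).$$ $Q_\theta^*$ is the transpose of $Q_\theta$, acting on column vectors of $\mathbb{R}^N$; $|\cdot|_1$ is the $\ell^1$-norm on $\mathbb{R}^N$ and $\|\cdot\|_{1\to1}$ the induced operator norm. $|\cdot|$ is the Euclidean norm on $\mathbb{R}^d$ and $\mathbb{R}^m$. $X$ carries the metric $d_X((\theta,w,\mu),(\bar\theta,\bar w,\bar\mu))=|\theta-\bar\theta|+|w-\bar w|+|\mu-\bar\mu|_1$, and $Y$ the metric $|\theta-\bar\theta|+|w-\bar w|$. Under the stated mixing hypothesis, for each $\theta$ there is exactly one $\mu_\theta\in\Delta_S$ with $Q_\theta^*\mu_\theta=0$. Constants: $M_r=\max_{i,a}|r_{i,a}|$, $M_\varphi=\max_{i,a}|\varphi_{i,a}|$, $B_b=M_rM_\varphi$, $R_w=\max\{1,2B_b/\lambda_c\}$; $\overline{B_{R_w}(0)}$ is the closed Euclidean ball of radius $R_w$ in $\mathbb{R}^m$. Terminology. An ODE system generates a continuous semiflow $\bar S(t)$ on $Y$ if for each $y_0\in Y$ there is a unique $Y$-valued solution on $[0,\infty)$ starting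 at $y_0$ and, with $\bar S(t)y_0$ its value at time $t$, $\bar S(0)=\mathrm{Id}$, $\bar S(t+s)=\bar S(t)\bar S(s)$, and $(t,y)\mapsto\bar S(t)y$ is continuous. $K_Y$ is forward invariant if $\bar S(t)K_Y\subset K_Y$ for all $t\ge0$, and absorbing if for every bounded $B\subset Y$ there is $T_B\ge0$ with $\bar S(t)B\subset K_Y$ for all $t\ge T_B$. For a family of maps $F(t)$, $t\ge0$, of a metric space $(Z,d)$ into itself, a (compact) global attractor is a nonempty compact set $\mathcal{A}\subset Z$ with $F(t)\mathcal{A}=\mathcal{A}$ for all $t\ge0$ and $\sup_{x\in B}\inf_{y\in\mathcal{A}}d(F(t)x,y)\to0$ as $t\to\infty$ for every bounded $B\subset Z$. This is the sense in which $\widehat{\mathcal{A}}_0$ is the global attractor of the family $\Gamma_0(t)$ on $X$ (note that $\Gamma_0(0)$ is not the identity of $X$ but the map $(\theta_0,w_0,\mu_0)\mapsto(\theta_0,w_0,\mu_{\theta_0})$). $\omega(K_Y)=\bigcap_{s\ge0}\overline{\bigcup_{t\ge s}\bar S(t)K_Y}$. *)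

theory Defs
  imports "HOL-Analysis.Analysis"
begin

text \<open>States are the elements of a finite type \<open>'n\<close>, actions those of a finite type \<open>'k\<close>; the actor
  parameter lives in \<open>real ^ 'd\<close> and the critic parameter in \<open>real ^ 'm\<close>. All four types are
  nonempty, so \<open>N, K0, d, m \<ge> 1\<close> holds automatically.\<close>

definition norm1 :: "real ^ 'n \<Rightarrow> real" where
  "norm1 x = (\<Sum>i\<in>UNIV. \<bar>x $ i\<bar>)"

text \<open>Same shape as \<^const>\<open>onorm\<close>: the quotient is \<open>0\<close> at \<open>x = 0\<close> because \<open>t / 0 = 0\<close>.\<close>

definition opnorm1 :: "real ^ 'n ^ 'n \<Rightarrow> real" where
  "opnorm1 A = (SUP x. norm1 (A *v x) / norm1 x)"

definition mat_exp :: "real ^ 'n ^ 'n \<Rightarrow> real ^ 'n ^ 'n" where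
  "mat_exp A = (\<Sum>k. (1 / fact k) *\<^sub>R (((**) A ^^ k) (mat 1)))"

definition grad :: "('a::real_inner \<Rightarrow> real) \<Rightarrow> 'a \<Rightarrow> 'a" where
  "grad f x = (THE D. GDERIV f x :> D)"

definition actor_box :: "real \<Rightarrow> (real ^ 'd) set" where
  "actor_box R = {\<theta>. \<forall>j. \<theta> $ j \<in> {-R..R}}"

definition simplex_S :: "(real ^ 'n) set" where
  "simplex_S = {\<mu>. (\<forall>i. 0 \<le> \<mu> $ i) \<and> (\<Sum>i\<in>UNIV. \<mu> $ i) = 1}"

definition zero_sum :: "(real ^ 'n) set" where
  "zero_sum = {\<xi>. (\<Sum>i\<in>UNIV. \<xi> $ i) = 0}"

definition space_Y :: "real \<Rightarrow> ((real ^ 'd) \<times> (real ^ 'm)) set" where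
  "space_Y R = actor_box R \<times> UNIV"

definition space_X :: "real \<Rightarrow> ((real ^ 'd) \<times> (real ^ 'm) \<times> (real ^ 'n)) set" where
  "space_X R = actor_box R \<times> UNIV \<times> simplex_S"

definition dist_Y :: "(real ^ 'd) \<times> (real ^ 'm) \<Rightarrow> (real ^ 'd) \<times> (real ^ 'm) \<Rightarrow> real" where
  "dist_Y = (\<lambda>(\<theta>, w) (\<theta>', w'). norm (\<theta> - \<theta>') + norm (w - w'))"

definition dist_X ::
  "(real ^ 'd) \<times> (real ^ 'm) \<times> (real ^ 'n) \<Rightarrow> (real ^ 'd) \<times> (real ^ 'm) \<times> (real ^ 'n) \<Rightarrow> real" where
  "dist_X = (\<lambda>(\<theta>, w, \<mu>) (\<theta>', w', \<mu>').
      norm (\<theta> - \<theta>') + norm (w - w') + norm1 (\<mu> - \<mu>'))"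

lemma norm1_triangle: "norm1 (x + y) \<le> norm1 x + norm1 y"
  by (simp add: norm1_def flip: sum.distrib) (rule sum_mono, simp add: abs_triangle_ineq)

lemma norm1_eq_0: "norm1 x = 0 \<longleftrightarrow> x = 0"
  by (simp add: norm1_def sum_nonneg_eq_0_iff vec_eq_iff)

lemma Metric_space_dist_Y: "Metric_space S dist_Y"
proof
  fix x y z :: "(real ^ 'd) \<times> (real ^ 'm)"
  show "0 \<le> dist_Y x y" by (auto simp: dist_Y_def split: prod.splits)
  show "dist_Y x y = dist_Y y x"
    by (auto simp: dist_Y_def norm_minus_commute split: prod.splits)
  show "dist_Y x y = 0 \<longleftrightarrow> x = y"
    by (auto simp: dist_Y_def add_nonneg_eq_0_iff split: prod.splits)
  show "dist_Y x z \<le> dist_Y x y + dist_Y y z"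
    using norm_triangle_ineq[of "fst x - fst y" "fst y - fst z"]
      norm_triangle_ineq[of "snd x - snd y" "snd y - snd z"]
    by (auto simp: dist_Y_def split: prod.splits)
qed

lemma Metric_space_dist_X: "Metric_space S dist_X"
proof
  fix x y z :: "(real ^ 'd) \<times> (real ^ 'm) \<times> (real ^ 'n)"
  have nn: "0 \<le> norm1 u" for u :: "real ^ 'n" by (simp add: norm1_def sum_nonneg)
  have cm: "norm1 (u - v) = norm1 (v - u)" for u v :: "real ^ 'n"
    by (simp add: norm1_def abs_minus_commute)
  show "0 \<le> dist_X x y" by (auto simp: dist_X_def nn split: prod.splits)
  show "dist_X x y = dist_X y x"
    by (auto simp: dist_X_def norm_minus_commute cm split: prod.splits)
  show "dist_X x y = 0 \<longleftrightarrow> x = y"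
    by (auto simp: dist_X_def add_nonneg_eq_0_iff nn norm1_eq_0 split: prod.splits)
  show "dist_X x z \<le> dist_X x y + dist_X y z"
    using norm_triangle_ineq[of "fst x - fst y" "fst y - fst z"]
      norm_triangle_ineq[of "fst (snd x) - fst (snd y)" "fst (snd y) - fst (snd z)"]
      norm1_triangle[of "snd (snd x) - snd (snd y)" "snd (snd y) - snd (snd z)"]
    by (auto simp: dist_X_def split: prod.splits)
qed

definition policy :: "real \<Rightarrow> ('n::finite \<Rightarrow> 'k::finite \<Rightarrow> real ^ 'd) \<Rightarrow> real ^ 'd \<Rightarrow> 'n \<Rightarrow> 'k \<Rightarrow> real" where
  "policy \<tau> \<psi> \<theta> i a =
     exp ((\<psi> i a \<bullet> \<theta>) / \<tau>) / (\<Sum>b\<in>UNIV. exp ((\<psi> i b \<bullet> \<theta>) / \<tau>))"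

definition occupation ::
  "real \<Rightarrow> ('n::finite \<Rightarrow> 'k::finite \<Rightarrow> real ^ 'd) \<Rightarrow> real ^ 'd \<Rightarrow> real ^ 'n \<Rightarrow> 'n \<Rightarrow> 'k \<Rightarrow> real" where
  "occupation \<tau> \<psi> \<theta> \<mu> i a = \<mu> $ i * policy \<tau> \<psi> \<theta> i a"

definition critic_b ::
  "real \<Rightarrow> ('n::finite \<Rightarrow> 'k::finite \<Rightarrow> real) \<Rightarrow> ('n \<Rightarrow> 'k \<Rightarrow> real ^ 'd) \<Rightarrow> ('n \<Rightarrow> 'k \<Rightarrow> real ^ 'm)
    \<Rightarrow> real ^ 'd \<Rightarrow> real ^ 'n \<Rightarrow> real ^ 'm" where
  "critic_b \<tau> r \<psi> \<phi> \<theta> \<mu> =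
     (\<Sum>i\<in>UNIV. \<Sum>a\<in>UNIV. (occupation \<tau> \<psi> \<theta> \<mu> i a * r i a) *\<^sub>R \<phi> i a)"

definition critic_A ::
  "real \<Rightarrow> real \<Rightarrow> ('n::finite \<Rightarrow> 'k::finite \<Rightarrow> real ^ 'd) \<Rightarrow> ('n \<Rightarrow> 'k \<Rightarrow> real ^ 'm)
    \<Rightarrow> real ^ 'd \<Rightarrow> real ^ 'n \<Rightarrow> real ^ 'm ^ 'm" where
  "critic_A \<tau> lam_c \<psi> \<phi> \<theta> \<mu> =
     lam_c *\<^sub>R mat 1 + (\<Sum>i\<in>UNIV. \<Sum>a\<in>UNIV.
        occupation \<tau> \<psi> \<theta> \<mu> i a *\<^sub>R (\<chi> k l. \<phi> i a $ k * \<phi> i a $ l))"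

definition actor_Gtilde ::
  "real \<Rightarrow> ('n::finite \<Rightarrow> 'k::finite \<Rightarrow> real) \<Rightarrow> ('n \<Rightarrow> 'k \<Rightarrow> real ^ 'd) \<Rightarrow> ('n \<Rightarrow> 'k \<Rightarrow> real ^ 'm)
    \<Rightarrow> real ^ 'd \<Rightarrow> real ^ 'm \<Rightarrow> real ^ 'n \<Rightarrow> real ^ 'd" where
  "actor_Gtilde \<tau> r \<psi> \<phi> \<theta> w \<mu> =
     (\<Sum>i\<in>UNIV. \<Sum>a\<in>UNIV.
        (occupation \<tau> \<psi> \<theta> \<mu> i a * (r i a + \<phi> i a \<bullet> w - \<tau> * ln (policy \<tau> \<psi> \<theta> i a)))
          *\<^sub>R grad (\<lambda>\<theta>'. ln (policy \<tau> \<psi> \<theta>' i a)) \<theta>)"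

definition diag_D :: "real \<Rightarrow> real ^ 'd \<Rightarrow> real ^ 'd ^ 'd" where
  "diag_D R \<theta> = (\<chi> j l. if j = l then R\<^sup>2 - (\<theta> $ j)\<^sup>2 else 0)"

definition actor_G ::
  "real \<Rightarrow> real \<Rightarrow> ('n::finite \<Rightarrow> 'k::finite \<Rightarrow> real) \<Rightarrow> ('n \<Rightarrow> 'k \<Rightarrow> real ^ 'd) \<Rightarrow> ('n \<Rightarrow> 'k \<Rightarrow> real ^ 'm)
    \<Rightarrow> real ^ 'd \<Rightarrow> real ^ 'm \<Rightarrow> real ^ 'n \<Rightarrow> real ^ 'd" where
  "actor_G R \<tau> r \<psi> \<phi> \<theta> w \<mu> = diag_D R \<theta> *v actor_Gtilde \<tau> r \<psi> \<phi> \<theta> w \<mu>"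

definition radius_w ::
  "real \<Rightarrow> ('n::finite \<Rightarrow> 'k::finite \<Rightarrow> real) \<Rightarrow> ('n \<Rightarrow> 'k \<Rightarrow> real ^ 'm) \<Rightarrow> real" where
  "radius_w lam_c r \<phi> =
     (let M_r = Max (range (\<lambda>(i, a). \<bar>r i a\<bar>));
          M_\<phi> = Max (range (\<lambda>(i, a). norm (\<phi> i a)));
          B_b = M_r * M_\<phi>
      in max 1 (2 * B_b / lam_c))"

definition is_generator :: "real ^ 'n ^ 'n \<Rightarrow> bool" where
  "is_generator q \<longleftrightarrow>
     (\<forall>i j. i \<noteq> j \<longrightarrow> 0 \<le> q $ i $ j) \<and> (\<forall>i. q $ i $ i = - (\<Sum>j\<in>UNIV - {i}. q $ i $ j))"

definition invariant_law :: "(real ^ 'd \<Rightarrow> real ^ 'n ^ 'n) \<Rightarrow> real ^ 'd \<Rightarrow> real ^ 'n" where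
  "invariant_law Q \<theta> = (THE \<mu>. \<mu> \<in> simplex_S \<and> transpose (Q \<theta>) *v \<mu> = 0)"

definition reduced_field ::
  "real \<Rightarrow> real \<Rightarrow> real \<Rightarrow> ('n::finite \<Rightarrow> 'k::finite \<Rightarrow> real) \<Rightarrow> ('n \<Rightarrow> 'k \<Rightarrow> real ^ 'd) \<Rightarrow> ('n \<Rightarrow> 'k \<Rightarrow> real ^ 'm)
    \<Rightarrow> (real ^ 'd \<Rightarrow> real ^ 'n ^ 'n) \<Rightarrow> (real ^ 'd) \<times> (real ^ 'm) \<Rightarrow> (real ^ 'd) \<times> (real ^ 'm)" where
  "reduced_field R \<tau> lam_c r \<psi> \<phi> Q = (\<lambda>(\<theta>, w).
     let \<mu> = invariant_law Q \<theta>
     in (actor_G R \<tau> r \<psi> \<phi> \<theta> w \<mu>,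
         critic_b \<tau> r \<psi> \<phi> \<theta> \<mu> - critic_A \<tau> lam_c \<psi> \<phi> \<theta> \<mu> *v w))"

text \<open>The metric also measures differences of values of the vector field; this is meant for
  metrics on the ambient vector space that come from a norm.\<close>

definition locally_Lipschitz_in ::
  "'a set \<Rightarrow> ('a \<Rightarrow> 'a \<Rightarrow> real) \<Rightarrow> ('a \<Rightarrow> 'a) \<Rightarrow> bool" where
  "locally_Lipschitz_in Z d f \<longleftrightarrow>
     (\<forall>z\<in>Z. \<exists>\<epsilon>>0. \<exists>L. \<forall>x\<in>Metric_space.mball Z d z \<epsilon>. \<forall>y\<in>Metric_space.mball Z d z \<epsilon>.
        d (f x) (f y) \<le> L * d x y)"

text \<open>Solutions are functions on \<open>{0..}\<close>, made extensional so that uniqueness can be stated as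
  equality; at time \<open>0\<close> the derivative is one-sided.\<close>

definition is_solution ::
  "'a::real_normed_vector set \<Rightarrow> ('a \<Rightarrow> 'a) \<Rightarrow> 'a \<Rightarrow> (real \<Rightarrow> 'a) \<Rightarrow> bool" where
  "is_solution Z f z0 y \<longleftrightarrow>
     y \<in> {0..} \<rightarrow>\<^sub>E Z \<and> y 0 = z0 \<and>
     (\<forall>t\<ge>0. (y has_vector_derivative f (y t)) (at t within {0..}))"

definition solution_map ::
  "'a::real_normed_vector set \<Rightarrow> ('a \<Rightarrow> 'a) \<Rightarrow> real \<Rightarrow> 'a \<Rightarrow> 'a" where
  "solution_map Z f t z0 = (THE y. is_solution Z f z0 y) t"

definition generates_continuous_semiflow ::
  "'a::real_normed_vector set \<Rightarrow> ('a \<Rightarrow> 'a \<Rightarrow> real) \<Rightarrow> ('a \<Rightarrow> 'a) \<Rightarrow> bool" where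
  "generates_continuous_semiflow Z d f \<longleftrightarrow>
     (\<forall>z\<in>Z. \<exists>!y. is_solution Z f z y) \<and>
     (\<forall>z\<in>Z. solution_map Z f 0 z = z) \<and>
     (\<forall>t\<ge>0. \<forall>s\<ge>0. \<forall>z\<in>Z.
        solution_map Z f (t + s) z = solution_map Z f t (solution_map Z f s z)) \<and>
     continuous_map
       (prod_topology (top_of_set {0..}) (Metric_space.mtopology Z d))
       (Metric_space.mtopology Z d)
       (\<lambda>(t, z). solution_map Z f t z)"

definition forward_invariant :: "(real \<Rightarrow> 'a \<Rightarrow> 'a) \<Rightarrow> 'a set \<Rightarrow> bool" where
  "forward_invariant F K \<longleftrightarrow> (\<forall>t\<ge>0. F t ` K \<subseteq> K)"

definition absorbing ::
  "'a set \<Rightarrow> ('a \<Rightarrow> 'a \<Rightarrow> real) \<Rightarrow> (real \<Rightarrow> 'a \<Rightarrow> 'a) \<Rightarrow> 'a set \<Rightarrow> bool" where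
  "absorbing Z d F K \<longleftrightarrow>
     (\<forall>B. Metric_space.mbounded Z d B \<longrightarrow> (\<exists>T\<ge>0. \<forall>t\<ge>T. F t ` B \<subseteq> K))"

definition omega_limit ::
  "'a set \<Rightarrow> ('a \<Rightarrow> 'a \<Rightarrow> real) \<Rightarrow> (real \<Rightarrow> 'a \<Rightarrow> 'a) \<Rightarrow> 'a set \<Rightarrow> 'a set" where
  "omega_limit Z d F K =
     (\<Inter>s\<in>{0..}. Metric_space.mtopology Z d closure_of (\<Union>t\<in>{s..}. F t ` K))"

text \<open>The Hausdorff semidistance is taken in \<^typ>\<open>ennreal\<close>, where the supremum always exists.\<close>

definition global_attractor ::
  "'a set \<Rightarrow> ('a \<Rightarrow> 'a \<Rightarrow> real) \<Rightarrow> (real \<Rightarrow> 'a \<Rightarrow> 'a) \<Rightarrow> 'a set \<Rightarrow> bool" where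
  "global_attractor Z d F \<A> \<longleftrightarrow>
     (\<forall>t\<ge>0. F t \<in> Z \<rightarrow> Z) \<and>
     \<A> \<noteq> {} \<and> compactin (Metric_space.mtopology Z d) \<A> \<and>
     (\<forall>t\<ge>0. F t ` \<A> = \<A>) \<and>
     (\<forall>B. Metric_space.mbounded Z d B \<longrightarrow>
        ((\<lambda>t. SUP x\<in>B. INF y\<in>\<A>. ennreal (d (F t x) y)) \<longlongrightarrow> 0) at_top)"

definition lift_law ::
  "(real ^ 'd \<Rightarrow> real ^ 'n) \<Rightarrow> (real ^ 'd) \<times> (real ^ 'm) \<Rightarrow> (real ^ 'd) \<times> (real ^ 'm) \<times> (real ^ 'n)" where
  "lift_law law = (\<lambda>(\<theta>, w). (\<theta>, w, law \<theta>))"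

definition lifted_semiflow ::
  "(real ^ 'd \<Rightarrow> real ^ 'n) \<Rightarrow> (real \<Rightarrow> (real ^ 'd) \<times> (real ^ 'm) \<Rightarrow> (real ^ 'd) \<times> (real ^ 'm))
    \<Rightarrow> real \<Rightarrow> (real ^ 'd) \<times> (real ^ 'm) \<times> (real ^ 'n) \<Rightarrow> (real ^ 'd) \<times> (real ^ 'm) \<times> (real ^ 'n)" where
  "lifted_semiflow law S t = (\<lambda>(\<theta>0, w0, \<mu>0). lift_law law (S t (\<theta>0, w0)))"

end

(* The generator Q_theta^* is injective on zero-sum vectors, by mixing applied to e^{tQ^*} xi = xi; this
   gives the invariant law, and since by compactness the bound |Q_theta^* xi| >= c |xi| is uniform in
   theta, the law is Lipschitz in theta. The reduced field is then Lipschitz on each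
   Theta x (ball of radius rho). Truncating it by the projection onto such a tube gives a globally
   Lipschitz equation, whose solutions stay in the tube once rho >= R_w, because D vanishes on the faces
   of the box and A >= lambda_c I makes the critic point inward. Hence solutions are global, and
   (|w|^2)' <= -lambda_c (|w|^2 - R_w^2/4) makes K_Y absorbing. The attractor is the nested intersection
   of the compact sets S(t) K_Y, and the lift is a Lipschitz map that intertwines S(t) and Gamma_0(t). *)

theory Submission
  imports Defs
begin

section \<open>The metrics\<close>

text \<open>The reduced field is meaningful only on the closed set \<open>space_Y R\<close>, because
  nothing is assumed about \<open>Q\<close> off the box, and it is not globally Lipschitz there:
  terms such as A w have a Lipschitz constant in theta that grows with the norm of w. Truncation
  answers both difficulties at once. The tubes of radius at least R_w exhaust the space, so each
  bounded set of initial data has one Lipschitz constant that is valid for all times, and uniqueness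
  makes the solution independent of the tube. The radius R_w is at least twice the level B_b /
  lambda_c at which dissipation and forcing balance; the doubling makes solutions enter K_Y after a
  finite time. The maximum with 1 serves the same purpose: if B_b = 0, the critic merely decays
  exponentially and would never reach a ball of radius 0. The distances of the statement are
  equivalent to the Euclidean product distance. The analysis is carried out in the latter, and only
  the final assertions are translated back.\<close>

lemma mtopology_eq_top_of_set:
  fixes S :: "'a::metric_space set"
  assumes "Metric_space S d"
    and d: "\<And>x y. dist x y \<le> d x y" "\<And>x y. d x y \<le> c * dist x y"
  shows "Metric_space.mtopology S d = top_of_set S"
proof -
  interpret Metric_space S d by fact
  \<comment> \<open>The sign of \<open>c\<close> is not known; \<open>|c| + 1\<close> is a positive
    replacement by which a radius can be divided.\<close>
  have c: "d x y \<le> (\<bar>c\<bar> + 1) * dist x y" for x y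
    by (rule order_trans[OF d(2)], rule mult_right_mono) auto
  have "openin mtopology U \<longleftrightarrow> openin (top_of_set S) U" for U
    unfolding openin_mtopology openin_euclidean_subtopology_iff
  proof (intro conj_cong refl iffI ballI allI impI)
    fix x assume U: "U \<subseteq> S" "\<forall>x. x \<in> U \<longrightarrow> (\<exists>r>0. mball x r \<subseteq> U)" "x \<in> U"
    then obtain r where r: "r > 0" "mball x r \<subseteq> U" by blast
    show "\<exists>e>0. \<forall>x'\<in>S. dist x' x < e \<longrightarrow> x' \<in> U"
    proof (intro exI[of _ "r / (\<bar>c\<bar> + 1)"] conjI ballI impI)
      fix x' assume x': "x' \<in> S" "dist x' x < r / (\<bar>c\<bar> + 1)"
      then have "(\<bar>c\<bar> + 1) * dist x x' < r"
        by (simp add: field_simps dist_commute)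
      then have "d x x' < r" using c[of x x'] by simp
      then have "x' \<in> mball x r" using U(1,3) x'(1) by (simp add: subset_iff)
      then show "x' \<in> U" using r(2) by blast
    qed (use r in auto)
  next
    fix x assume U: "U \<subseteq> S" "\<forall>x\<in>U. \<exists>e>0. \<forall>x'\<in>S. dist x' x < e \<longrightarrow> x' \<in> U" "x \<in> U"
    then obtain e where e: "e > 0" "\<And>x'. x' \<in> S \<Longrightarrow> dist x' x < e \<Longrightarrow> x' \<in> U" by blast
    have "mball x e \<subseteq> U"
    proof
      fix x' assume "x' \<in> mball x e"
      then have "x' \<in> S" "d x x' < e" by simp_all
      then show "x' \<in> U" using e(2) d(1)[of x x'] by (simp add: dist_commute)
    qed
    then show "\<exists>r>0. mball x r \<subseteq> U" using e by blast
  qed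
  then show ?thesis by (simp add: topology_eq)
qed

lemma mbounded_imp_bounded:
  fixes S :: "'a::metric_space set"
  assumes "Metric_space S d" "\<And>x y. dist x y \<le> d x y" "Metric_space.mbounded S d B"
  shows "bounded B" "B \<subseteq> S"
proof -
  interpret Metric_space S d by fact
  show "B \<subseteq> S" using assms(3) mbounded_subset_mspace by blast
  show "bounded B"
  proof (cases "B = {}")
    case False
    obtain C where "\<forall>x\<in>B. \<forall>y\<in>B. d x y \<le> C" using assms(3) mbounded_alt by blast
    then show ?thesis
      using False assms(2) unfolding bounded_def by (meson all_not_in_conv order_trans)
  qed simp
qed

lemma norm1_nonneg: "0 \<le> norm1 x"
  by (simp add: norm1_def sum_nonneg)

lemma norm_le_norm1: "norm x \<le> norm1 x"
  using norm_le_l1_cart[of x] by (simp add: norm1_def)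

lemma norm1_le_norm: "norm1 x \<le> real CARD('n) * norm (x :: real ^ 'n)"
  using sum_mono[of UNIV "\<lambda>i. \<bar>x $ i\<bar>" "\<lambda>_. norm x"] by (simp add: norm1_def component_le_norm_cart)

lemma dist_le_dist_Y: "dist x y \<le> dist_Y x y"
  by (auto simp: dist_Y_def dist_prod_def dist_norm sqrt_sum_squares_le_sum split: prod.splits)

lemma dist_Y_le_dist: "dist_Y x y \<le> 2 * dist x y"
  using dist_fst_le[of x y] dist_snd_le[of x y]
  by (auto simp: dist_Y_def dist_norm split: prod.splits)

lemma dist_Pair_le: "dist (a, b) (c, d) \<le> dist a c + dist b d"
  unfolding dist_Pair_Pair by (rule sqrt_sum_squares_le_sum) simp_all

lemma dist_le_dist_X: "dist x y \<le> dist_X x y"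
proof -
  obtain \<theta> w \<mu> \<theta>' w' \<mu>' where xy: "x = (\<theta>, w, \<mu>)" "y = (\<theta>', w', \<mu>')" by (metis prod.exhaust)
  have "dist x y \<le> dist \<theta> \<theta>' + dist (w, \<mu>) (w', \<mu>')"
    unfolding xy by (rule dist_Pair_le)
  also have "dist (w, \<mu>) (w', \<mu>') \<le> dist w w' + dist \<mu> \<mu>'"
    by (rule dist_Pair_le)
  also have "dist \<mu> \<mu>' \<le> norm1 (\<mu> - \<mu>')"
    unfolding dist_norm by (rule norm_le_norm1)
  finally show ?thesis by (simp add: xy dist_X_def dist_norm)
qed

lemma dist_X_le_dist:
  fixes x y :: "(real ^ 'd) \<times> (real ^ 'm) \<times> (real ^ 'n)"
  shows "dist_X x y \<le> (2 + real CARD('n)) * dist x y"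
proof -
  obtain \<theta> w \<mu> \<theta>' w' \<mu>' where xy: "x = (\<theta>, w, \<mu>)" "y = (\<theta>', w', \<mu>')" by (metis prod.exhaust)
  have snd_le: "dist (w, \<mu>) (w', \<mu>') \<le> dist x y"
    using dist_snd_le[of x y] by (simp add: xy)
  have \<theta>: "norm (\<theta> - \<theta>') \<le> dist x y"
    using dist_fst_le[of x y] by (simp add: xy dist_norm)
  have w: "norm (w - w') \<le> dist x y"
    using dist_fst_le[of "(w, \<mu>)" "(w', \<mu>')"] snd_le by (simp add: dist_norm)
  have \<mu>: "norm (\<mu> - \<mu>') \<le> dist x y"
    using dist_snd_le[of "(w, \<mu>)" "(w', \<mu>')"] snd_le by (simp add: dist_norm)
  have "norm1 (\<mu> - \<mu>') \<le> real CARD('n) * dist x y"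
    by (rule order_trans[OF norm1_le_norm mult_left_mono[OF \<mu>]]) simp
  with \<theta> w have "norm (\<theta> - \<theta>') + norm (w - w') + norm1 (\<mu> - \<mu>')
      \<le> dist x y + dist x y + real CARD('n) * dist x y"
    by (intro add_mono)
  then show ?thesis by (simp add: xy dist_X_def algebra_simps)
qed

lemmas mtopology_dist_Y = mtopology_eq_top_of_set[OF Metric_space_dist_Y dist_le_dist_Y dist_Y_le_dist]
lemmas mtopology_dist_X = mtopology_eq_top_of_set[OF Metric_space_dist_X dist_le_dist_X dist_X_le_dist]

section \<open>Ordinary differential equations\<close>

text \<open>Differentiability at \<open>t\<close> is local, so the half-line may be replaced by
  \<open>{0..t + 1}\<close>; the extra unit keeps \<open>t\<close> away from the right end.\<close>

lemma integral_has_vector_derivative_atLeast: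
  fixes g :: "real \<Rightarrow> 'a::banach"
  assumes "continuous_on UNIV g" "0 \<le> t"
  shows "((\<lambda>u. integral {0..u} g) has_vector_derivative g t) (at t within {0..})"
proof -
  have "((\<lambda>u. integral {0..u} g) has_vector_derivative g t) (at t within {0..t + 1})"
    using assms by (intro integral_has_vector_derivative) (auto intro: continuous_on_subset)
  moreover have "at t within {0..t + 1} = at t within {0..}"
    by (rule at_within_nhd[where S = "{..<t + 1}"]) auto
  ultimately show ?thesis by simp
qed

text \<open>The integral of \<open>M * exp (c * s)\<close> is at most
  \<open>M / c * exp (c * t)\<close>, and the weight cancels this growth, so the bound is uniform in
  \<open>t\<close>. It gives both the boundedness of Picard iterates and their contraction factor
  \<open>L / c\<close>.\<close>

lemma exp_weighted_integral_bound:
  fixes g :: "real \<Rightarrow> 'a::banach"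
  assumes "continuous_on UNIV g" "0 \<le> t" "0 < c" "0 \<le> M"
    and g: "\<And>s. 0 \<le> s \<Longrightarrow> norm (g s) \<le> M * exp (c * s)"
  shows "norm (exp (- c * t) *\<^sub>R integral {0..t} g) \<le> M / c"
proof -
  have "((\<lambda>s. M * exp (c * s)) has_integral M / c * exp (c * t) - M / c * exp (c * 0)) {0..t}"
    using assms(2,3)
    by (intro fundamental_theorem_of_calculus)
       (auto intro!: derivative_eq_intros simp flip: has_real_derivative_iff_has_vector_derivative)
  then have I: "(\<lambda>s. M * exp (c * s)) integrable_on {0..t}"
    "integral {0..t} (\<lambda>s. M * exp (c * s)) = M / c * exp (c * t) - M / c"
    by (auto simp: has_integral_iff)
  have "norm (integral {0..t} g) \<le> integral {0..t} (\<lambda>s. M * exp (c * s))"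
  proof (rule integral_norm_bound_integral[OF _ I(1)])
    show "g integrable_on {0..t}"
      using assms(1) by (intro integrable_continuous_real) (auto intro: continuous_on_subset)
  qed (use g in auto)
  also have "\<dots> \<le> M / c * exp (c * t)"
    using I assms by simp
  finally have "exp (- c * t) * norm (integral {0..t} g) \<le> exp (- c * t) * (M / c * exp (c * t))"
    by (intro mult_left_mono) auto
  also have "\<dots> = M / c"
    by (simp add: exp_minus field_simps)
  finally show ?thesis by simp
qed

text \<open>The substitution \<open>y t = y0 + exp (c * t) *\<^sub>R z t\<close> with \<open>c\<close> above twice the Lipschitz constant turns
  the integral equation on the whole half-line into a contraction of bounded continuous functions.\<close>

lemma global_lipschitz_solution_exists:
  fixes f :: "'a::banach \<Rightarrow> 'a"
  assumes lip: "L-lipschitz_on UNIV f"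
  shows "\<exists>y. y 0 = y0 \<and> (\<forall>t\<ge>0. (y has_vector_derivative f (y t)) (at t within {0..}))"
proof -
  define c where "c = 2 * L + 1"
  have L: "0 \<le> L" using lip by (rule lipschitz_on_nonneg)
  then have c: "0 < c" "L / c \<le> 1 / 2" by (auto simp: c_def field_simps)
  define g where "g z s = f (y0 + exp (c * s) *\<^sub>R apply_bcontfun z s)" for z s
  define h where "h z t = exp (- c * t) *\<^sub>R integral {0..t} (g z)" for z t
  have cont_f: "continuous_on UNIV f"
    using lip by (rule lipschitz_on_continuous_on)
  have cont_g: "continuous_on UNIV (g z)" for z
    unfolding g_def
    by (rule continuous_on_compose2[OF cont_f]) (auto intro!: continuous_intros)
  have deriv_I: "((\<lambda>u. integral {0..u} (g z)) has_vector_derivative g z t) (at t within {0..})"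
    if "0 \<le> t" for z t
    using integral_has_vector_derivative_atLeast[OF cont_g that] .
  have cont_I: "continuous_on {0..} (\<lambda>u. integral {0..u} (g z))" for z
    unfolding continuous_on_eq_continuous_within
    using deriv_I has_vector_derivative_continuous by blast
  have h_bound: "norm (h z t) \<le> (norm (f y0) + L * B) / c"
    if t: "0 \<le> t" and B: "\<And>x. norm (apply_bcontfun z x) \<le> B" for z t B
    unfolding h_def
  proof (rule exp_weighted_integral_bound[OF cont_g t c(1)])
    have B0: "0 \<le> B" using B[of 0] norm_ge_zero order_trans by blast
    then show "0 \<le> norm (f y0) + L * B" using L by simp
    fix s :: real assume s: "0 \<le> s"
    have e: "1 \<le> exp (c * s)" using c s by simp
    have "norm (g z s) \<le> norm (f y0) + norm (g z s - f y0)"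
      using norm_triangle_ineq[of "f y0" "g z s - f y0"] by simp
    also have "norm (g z s - f y0) \<le> L * norm (exp (c * s) *\<^sub>R apply_bcontfun z s)"
      using lipschitz_on_normD[OF lip, of "y0 + exp (c * s) *\<^sub>R apply_bcontfun z s" y0]
      by (simp add: g_def)
    also have "\<dots> \<le> L * (exp (c * s) * B)"
      using L B by (intro mult_left_mono) auto
    also have "norm (f y0) + L * (exp (c * s) * B) \<le> (norm (f y0) + L * B) * exp (c * s)"
      using e mult_left_mono[OF e, of "norm (f y0)"] by (simp add: algebra_simps)
    finally show "norm (g z s) \<le> (norm (f y0) + L * B) * exp (c * s)" by simp
  qed
  \<comment> \<open>Elements of \<open>bcontfun\<close> live on the whole line: clamping the time at
    0 extends \<open>h z\<close> to negative times by its value 0 at time 0.\<close>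
  have h_mem: "(\<lambda>t. h z (max 0 t)) \<in> bcontfun" for z
  proof -
    obtain B where B: "\<And>x. norm (apply_bcontfun z x) \<le> B"
      using bounded_apply_bcontfun[of z] by (auto simp: bounded_iff)
    have "continuous_on {0..} (h z)"
      unfolding h_def by (intro continuous_intros cont_I)
    then have "continuous_on UNIV (\<lambda>t. h z (max 0 t))"
      by (rule continuous_on_compose2) (auto intro!: continuous_intros)
    moreover have "bounded (range (\<lambda>t. h z (max 0 t)))"
      unfolding bounded_iff using h_bound[OF _ B] by (intro exI[of _ "(norm (f y0) + L * B) / c"]) auto
    ultimately show ?thesis by (simp add: bcontfun_def)
  qed
  define \<Phi> where "\<Phi> z = Bcontfun (\<lambda>t. h z (max 0 t))" for z
  have \<Phi>: "apply_bcontfun (\<Phi> z) t = h z (max 0 t)" for z t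
    by (simp add: \<Phi>_def Bcontfun_inverse h_mem)
  have "dist (\<Phi> z) (\<Phi> z') \<le> 1 / 2 * dist z z'" for z z'
  proof (rule dist_bound)
    fix x :: real
    define t where "t = max 0 x"
    have t: "0 \<le> t" by (simp add: t_def)
    have "norm (exp (- c * t) *\<^sub>R integral {0..t} (\<lambda>s. g z s - g z' s)) \<le> L * dist z z' / c"
    proof (rule exp_weighted_integral_bound[OF _ t c(1)])
      show "continuous_on UNIV (\<lambda>s. g z s - g z' s)"
        by (intro continuous_intros cont_g)
      show "0 \<le> L * dist z z'" using L by simp
      fix s :: real
      have "norm (g z s - g z' s) \<le> L * (exp (c * s) * dist (apply_bcontfun z s) (apply_bcontfun z' s))"
        using lipschitz_on_normD[OF lip, of "y0 + exp (c * s) *\<^sub>R apply_bcontfun z s"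
            "y0 + exp (c * s) *\<^sub>R apply_bcontfun z' s"]
        by (simp add: g_def dist_norm flip: scaleR_diff_right)
      also have "\<dots> \<le> L * (exp (c * s) * dist z z')"
        using L by (intro mult_left_mono dist_bounded) auto
      finally show "norm (g z s - g z' s) \<le> L * dist z z' * exp (c * s)"
        by (simp add: algebra_simps)
    qed
    also have "integral {0..t} (\<lambda>s. g z s - g z' s) = integral {0..t} (g z) - integral {0..t} (g z')"
      using cont_g
      by (intro integral_diff integrable_continuous_real) (auto intro: continuous_on_subset)
    finally have "dist (\<Phi> z x) (\<Phi> z' x) \<le> L / c * dist z z'"
      by (simp add: \<Phi> h_def dist_norm scaleR_diff_right flip: t_def)
    also have "\<dots> \<le> 1 / 2 * dist z z'"
      using c by (intro mult_right_mono) auto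
    finally show "dist (\<Phi> z x) (\<Phi> z' x) \<le> 1 / 2 * dist z z'" .
  qed
  then obtain z where z: "\<Phi> z = z"
    using banach_fix_type[of "1 / 2" \<Phi>] by auto
  define y where "y t = y0 + integral {0..t} (g z)" for t
  \<comment> \<open>The fixed point equation says that \<open>exp (c * t)\<close> times
    \<open>z t\<close> is the integral of \<open>g z\<close>, so the argument of \<open>f\<close>
    inside \<open>g z t\<close> is \<open>y t\<close> itself.\<close>
  have g_y: "g z t = f (y t)" if "0 \<le> t" for t
    using \<Phi>[of z t] that by (simp add: z g_def y_def h_def max_def flip: exp_add)
  have "(y has_vector_derivative f (y t)) (at t within {0..})" if "0 \<le> t" for t
    using deriv_I[OF that, of z] g_y[OF that]
    by (auto simp: y_def[abs_def] intro!: derivative_eq_intros)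
  moreover have "y 0 = y0" by (simp add: y_def)
  ultimately show ?thesis by blast
qed

text \<open>A barrier argument: after the last time \<open>s < t\<close> with
  \<open>u s \<le> c\<close> the function is strictly above the barrier, so the mean value theorem
  yields \<open>u t \<le> u s\<close>, a contradiction. The sign of the derivative matters only
  strictly above \<open>c\<close>, which suits the truncated field; with \<open>c = u 0\<close> the
  lemma also serves as a monotonicity test.\<close>

lemma stays_below:
  fixes u u' :: "real \<Rightarrow> real"
  assumes deriv: "\<And>t. t \<in> {0..T} \<Longrightarrow> (u has_real_derivative u' t) (at t within {0..T})"
    and u0: "u 0 \<le> c"
    and le: "\<And>t. t \<in> {0..T} \<Longrightarrow> c < u t \<Longrightarrow> u' t \<le> 0"
    and t: "t \<in> {0..T}"
  shows "u t \<le> c"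
proof (rule ccontr)
  assume "\<not> u t \<le> c"
  define E where "E = {0..t} \<inter> u -` {..c}"
  have cont: "continuous_on {0..T} u"
    unfolding continuous_on_eq_continuous_within using deriv DERIV_continuous by blast
  then have "continuous_on {0..t} u"
    using t by (auto intro: continuous_on_subset)
  then have "closed E"
    unfolding E_def by (intro continuous_closed_preimage) auto
  moreover have "bounded E"
    by (rule bounded_subset[of "{0..t}"]) (auto simp: E_def)
  ultimately have "compact E" by (simp add: compact_eq_bounded_closed)
  moreover have "E \<noteq> {}" using u0 t by (auto simp: E_def)
  ultimately obtain s where s: "s \<in> E" "\<And>s'. s' \<in> E \<Longrightarrow> s' \<le> s"
    using compact_attains_sup by metis
  then have st: "0 \<le> s" "s < t" "u s \<le> c" using \<open>\<not> u t \<le> c\<close>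
    by (auto simp: E_def less_le)
  have above: "c < u x" if "s < x" "x \<le> t" for x
    using s(2)[of x] that st by (force simp: E_def)
  have "\<exists>x\<in>{s<..<t}. u t - u s = u' x * (t - s)"
    using st t
    by (intro mvt_simple) (auto intro!: has_field_derivative_subset[OF deriv]
         simp flip: has_field_derivative_def)
  then obtain x where x: "x \<in> {s<..<t}" "u t - u s = u' x * (t - s)" by blast
  have "u' x \<le> 0" using le[of x] above[of x] x st t by auto
  then have "u' x * (t - s) \<le> 0" using st by (simp add: mult_nonpos_nonneg)
  then show False using x st \<open>\<not> u t \<le> c\<close> by linarith
qed

text \<open>Gronwall for the squared distance, which is differentiable even where the solutions
  meet: by Cauchy-Schwarz its product with \<open>exp (- 2 * L * t)\<close> has a nonpositive
  derivative.\<close>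

lemma norm_diff_solutions_le:
  fixes V :: "'a::real_inner \<Rightarrow> 'a"
  assumes lip: "L-lipschitz_on K V"
    and y1: "\<And>t. t \<in> {0..T} \<Longrightarrow> (y1 has_vector_derivative V (y1 t)) (at t within {0..T})"
    and y2: "\<And>t. t \<in> {0..T} \<Longrightarrow> (y2 has_vector_derivative V (y2 t)) (at t within {0..T})"
    and K: "y1 ` {0..T} \<subseteq> K" "y2 ` {0..T} \<subseteq> K"
    and t: "t \<in> {0..T}"
  shows "norm (y1 t - y2 t) \<le> exp (L * t) * norm (y1 0 - y2 0)"
proof -
  define v where "v t = y1 t - y2 t" for t
  define u where "u t = exp (- 2 * L * t) * (v t \<bullet> v t)" for t
  define u' where "u' t = exp (- 2 * L * t) * (2 * (v t \<bullet> (V (y1 t) - V (y2 t))))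
    + exp (- 2 * L * t) * (- 2 * L) * (v t \<bullet> v t)" for t
  have "u t \<le> u 0"
  proof (rule stays_below[where u = u and u' = u' and T = T])
    fix s assume s: "s \<in> {0..T}"
    have "(v has_vector_derivative V (y1 s) - V (y2 s)) (at s within {0..T})"
      unfolding v_def[abs_def] using y1[OF s] y2[OF s] by (rule has_vector_derivative_diff)
    then have "((\<lambda>t. v t \<bullet> v t) has_vector_derivative
        v s \<bullet> (V (y1 s) - V (y2 s)) + (V (y1 s) - V (y2 s)) \<bullet> v s) (at s within {0..T})"
      by (intro bounded_bilinear.has_vector_derivative[OF bounded_bilinear_inner])
    then have "((\<lambda>t. v t \<bullet> v t) has_real_derivative 2 * (v s \<bullet> (V (y1 s) - V (y2 s)))) (at s within {0..T})"
      by (simp add: has_real_derivative_iff_has_vector_derivative inner_commute)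
    then show "(u has_real_derivative u' s) (at s within {0..T})"
      unfolding u_def[abs_def] u'_def by (auto intro!: derivative_eq_intros)
    have "v s \<bullet> (V (y1 s) - V (y2 s)) \<le> norm (v s) * norm (V (y1 s) - V (y2 s))"
      by (rule norm_cauchy_schwarz)
    also have "\<dots> \<le> norm (v s) * (L * norm (v s))"
      using K s unfolding v_def by (intro mult_left_mono lipschitz_on_normD[OF lip]) auto
    also have "\<dots> = L * (v s \<bullet> v s)"
      by (simp add: dot_square_norm power2_eq_square)
    finally have "exp (- 2 * L * s) * (2 * (v s \<bullet> (V (y1 s) - V (y2 s))))
      \<le> exp (- 2 * L * s) * (2 * (L * (v s \<bullet> v s)))"
      by (intro mult_left_mono) auto
    then show "u' s \<le> 0" unfolding u'_def by simp
  qed (use t in auto)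
  then have "exp (- 2 * L * t) * (norm (v t))\<^sup>2 \<le> (norm (v 0))\<^sup>2"
    by (simp add: u_def dot_square_norm)
  then have "(norm (v t))\<^sup>2 \<le> exp (2 * L * t) * (norm (v 0))\<^sup>2"
    by (simp add: exp_minus field_simps)
  also have "\<dots> = (exp (L * t) * norm (v 0))\<^sup>2"
    by (simp add: power_mult_distrib power2_eq_square mult.assoc flip: exp_add)
  finally show ?thesis
    unfolding v_def by (rule power2_le_imp_le) simp
qed

section \<open>Semiflows\<close>

text \<open>The set \<open>K\<close> provides the a priori bound: it contains all solutions that start in \<open>B\<close>.\<close>

locale lipschitz_flow =
  fixes Z :: "'a::real_inner set" and V :: "'a \<Rightarrow> 'a"
  assumes enclosure: "\<And>B. bounded B \<Longrightarrow> B \<subseteq> Z \<Longrightarrow> \<exists>K L. bounded K \<and> B \<subseteq> K \<and> K \<subseteq> Z \<and> L-lipschitz_on K V \<and>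
    (\<forall>z\<in>K. \<exists>y. is_solution Z V z y \<and> y ` {0..} \<subseteq> K)"
begin

lemma solution_derivative_interval:
  assumes "is_solution Z V z y" "t \<in> {0..T}"
  shows "(y has_vector_derivative V (y t)) (at t within {0..T})"
  using assms unfolding is_solution_def
  by (auto intro: has_vector_derivative_within_subset)

lemma solution_continuous_on:
  assumes "is_solution Z V z y"
  shows "continuous_on {0..} y"
  using assms unfolding is_solution_def continuous_on_eq_continuous_within
  using has_vector_derivative_continuous by fastforce

lemma solution_mem: "is_solution Z V z y \<Longrightarrow> 0 \<le> t \<Longrightarrow> y t \<in> Z"
  by (auto simp: is_solution_def PiE_iff)

text \<open>Up to time \<open>t\<close> both curves trace a compact subset of \<open>Z\<close>,
  which lies in one set where \<open>V\<close> is Lipschitz, so Gronwall applies. At negative times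
  the two agree by extensionality.\<close>

lemma solution_unique:
  assumes "is_solution Z V z y1" "is_solution Z V z y2"
  shows "y1 = y2"
proof (rule ext)
  fix t :: real
  show "y1 t = y2 t"
  proof (cases "0 \<le> t")
    case True
    define B where "B = y1 ` {0..t} \<union> y2 ` {0..t}"
    have "compact (y ` {0..t})" if "is_solution Z V z y" for y
      using that by (intro compact_continuous_image continuous_on_subset[OF solution_continuous_on]) auto
    then have "bounded B"
      using assms by (auto simp: B_def compact_imp_bounded)
    moreover have "B \<subseteq> Z"
      using assms solution_mem by (auto simp: B_def)
    ultimately obtain K L where K: "B \<subseteq> K" "L-lipschitz_on K V"
      using enclosure by meson
    have "norm (y1 t - y2 t) \<le> exp (L * t) * norm (y1 0 - y2 0)"
      using assms K True
      by (intro norm_diff_solutions_le[where T = t, OF K(2)] solution_derivative_interval)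
         (auto simp: B_def)
    then show ?thesis
      using assms by (simp add: is_solution_def)
  next
    case False
    then show ?thesis
      using assms by (auto simp: is_solution_def PiE_iff extensional_def)
  qed
qed

lemma solution_exists: "z \<in> Z \<Longrightarrow> \<exists>y. is_solution Z V z y"
  using enclosure[of "{z}"] by auto

abbreviation flow :: "real \<Rightarrow> 'a \<Rightarrow> 'a"
  where "flow \<equiv> solution_map Z V"

lemma flow_eq: "is_solution Z V z y \<Longrightarrow> flow t z = y t"
  unfolding solution_map_def using solution_unique by (metis the_equality)

lemma is_solution_flow:
  assumes "z \<in> Z"
  shows "is_solution Z V z (\<lambda>t. flow t z)"
proof -
  obtain y where y: "is_solution Z V z y"
    using solution_exists assms by blast
  then have "(\<lambda>t. flow t z) = y"
    using flow_eq by blast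
  then show ?thesis using y by simp
qed

lemma flow_mem: "z \<in> Z \<Longrightarrow> 0 \<le> t \<Longrightarrow> flow t z \<in> Z"
  using solution_mem is_solution_flow by blast

lemma flow_0: "z \<in> Z \<Longrightarrow> flow 0 z = z"
  using is_solution_flow by (auto simp: is_solution_def)

lemma flow_add:
  assumes z: "z \<in> Z" and s: "0 \<le> s" and t: "0 \<le> t"
  shows "flow (t + s) z = flow t (flow s z)"
proof -
  \<comment> \<open>For times between \<open>- s\<close> and 0 the shifted flow still has genuine
    values, whereas \<open>is_solution\<close> demands an extensional function.\<close>
  define y where "y = restrict (\<lambda>t. flow (t + s) z) {0..}"
  have "is_solution Z V (flow s z) y"
    unfolding is_solution_def
  proof (intro conjI allI impI)
    show "y \<in> {0..} \<rightarrow>\<^sub>E Z"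
      using flow_mem[OF z] s by (auto simp: y_def)
    show "y 0 = flow s z" by (simp add: y_def)
    fix u :: real assume u: "0 \<le> u"
    have "((\<lambda>t. flow t z) has_vector_derivative V (flow (u + s) z)) (at (u + s) within {0..})"
      using is_solution_flow[OF z] u s by (simp add: is_solution_def)
    then have "((\<lambda>t. flow t z) has_vector_derivative V (flow (u + s) z)) (at (u + s) within (\<lambda>t. t + s) ` {0..})"
      by (rule has_vector_derivative_within_subset) (use s in auto)
    moreover have "((\<lambda>t. t + s) has_vector_derivative 1) (at u within {0..})"
      by (auto intro!: derivative_eq_intros)
    ultimately have "(((\<lambda>t. flow t z) \<circ> (\<lambda>t. t + s)) has_vector_derivative 1 *\<^sub>R V (flow (u + s) z)) (at u within {0..})"
      by (intro vector_diff_chain_within)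
    moreover have "V (y u) = V (flow (u + s) z)" using u by (simp add: y_def)
    ultimately have *: "((\<lambda>t. flow (t + s) z) has_vector_derivative V (y u)) (at u within {0..})"
      by (simp add: o_def)
    show "(y has_vector_derivative V (y u)) (at u within {0..})"
      by (rule has_vector_derivative_transform[OF _ _ *]) (use u in \<open>auto simp: y_def\<close>)
  qed
  then have "flow t (flow s z) = y t" by (rule flow_eq)
  then show ?thesis using t by (simp add: y_def)
qed

text \<open>All solutions that start in \<open>B\<close> remain in one enclosure, so a single
  Lipschitz constant enters the Gronwall bound at every time.\<close>

lemma flow_exp_lipschitz:
  assumes "bounded B" "B \<subseteq> Z"
  obtains L where "\<And>z z' t. z \<in> B \<Longrightarrow> z' \<in> B \<Longrightarrow> 0 \<le> t \<Longrightarrow> norm (flow t z - flow t z') \<le> exp (L * t) * norm (z - z')"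
proof -
  obtain K L where K: "B \<subseteq> K" "K \<subseteq> Z" "L-lipschitz_on K V"
    "\<And>z. z \<in> K \<Longrightarrow> \<exists>y. is_solution Z V z y \<and> y ` {0..} \<subseteq> K"
    using enclosure[OF assms] by meson
  have inK: "flow t z \<in> K" if "z \<in> K" "0 \<le> t" for t z
    using K(4)[OF that(1)] flow_eq that(2) by fastforce
  have "norm (flow t z - flow t z') \<le> exp (L * t) * norm (z - z')"
    if "z \<in> B" "z' \<in> B" "0 \<le> t" for z z' t
  proof -
    have "norm (flow t z - flow t z') \<le> exp (L * t) * norm (flow 0 z - flow 0 z')"
      using K inK that
      by (intro norm_diff_solutions_le[where T = t, OF K(3)] solution_derivative_interval)
         (auto intro: is_solution_flow)
    then show ?thesis using K that by (simp add: flow_0 subset_iff)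
  qed
  then show thesis using that by blast
qed

text \<open>Near \<open>(t0, z0)\<close> the increment is split at \<open>flow t z0\<close>: the
  dependence on the initial value is Lipschitz with a factor bounded for \<open>t\<close> near
  \<open>t0\<close>, and what remains is the continuity of one trajectory.\<close>

lemma continuous_on_flow: "continuous_on ({0..} \<times> Z) (\<lambda>(t, z). flow t z)"
  unfolding continuous_on_def
proof (intro ballI)
  fix p assume "p \<in> {0::real..} \<times> Z"
  then obtain t0 z0 where p: "p = (t0, z0)" "0 \<le> t0" "z0 \<in> Z" by auto
  let ?F = "at p within {0..} \<times> Z"
  obtain L where L: "\<And>z z' t. z \<in> cball z0 1 \<inter> Z \<Longrightarrow> z' \<in> cball z0 1 \<inter> Z \<Longrightarrow> 0 \<le> t
      \<Longrightarrow> norm (flow t z - flow t z') \<le> exp (L * t) * norm (z - z')"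
    using flow_exp_lipschitz[of "cball z0 1 \<inter> Z"] bounded_cball by (metis Int_lower2 bounded_Int)
  have lim: "(fst \<longlongrightarrow> t0) ?F" "(snd \<longlongrightarrow> z0) ?F"
    unfolding p by (auto intro!: tendsto_eq_intros)
  have ev: "\<forall>\<^sub>F q in ?F. q \<in> {0..} \<times> Z"
    by (simp add: eventually_at_filter)
  have "continuous_on {0..} (\<lambda>t. flow t z0)"
    using solution_continuous_on[OF is_solution_flow[OF p(3)]] by simp
  then have lim1: "((\<lambda>q. flow (fst q) z0) \<longlongrightarrow> flow t0 z0) ?F"
    using lim(1) p(2) ev
    by (intro continuous_on_tendsto_compose[where f = "\<lambda>t. flow t z0" and s = "{0..}"])
       (auto elim: eventually_mono)
  have "((\<lambda>q. exp (L * fst q) * norm (snd q - z0)) \<longlongrightarrow> exp (L * t0) * norm (z0 - z0)) ?F"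
    by (intro tendsto_intros lim)
  then have zero: "((\<lambda>q. exp (L * fst q) * norm (snd q - z0)) \<longlongrightarrow> 0) ?F" by simp
  have "\<forall>\<^sub>F q in ?F. dist (snd q) z0 < 1"
    using lim(2) by (rule tendstoD) simp
  with ev have "\<forall>\<^sub>F q in ?F. norm (flow (fst q) (snd q) - flow (fst q) z0) \<le> exp (L * fst q) * norm (snd q - z0)"
    by eventually_elim (use p in \<open>auto intro!: L simp: dist_commute less_imp_le\<close>)
  then have "((\<lambda>q. flow (fst q) (snd q) - flow (fst q) z0) \<longlongrightarrow> 0) ?F"
    using zero by (rule Lim_null_comparison)
  from tendsto_add[OF this lim1]
  show "((\<lambda>(t, z). flow t z) \<longlongrightarrow> (case p of (t, z) \<Rightarrow> flow t z)) ?F"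
    by (simp add: p case_prod_unfold)
qed

end

section \<open>Attractors\<close>

text \<open>Cantor's intersection theorem for the compact sets \<open>C s - U\<close>, taken along
  the integers, which are cofinal. For \<open>U = {}\<close> it says that an empty intersection has
  an empty member.\<close>

lemma compact_nested_subset_open:
  fixes C :: "real \<Rightarrow> 'a::heine_borel set"
  assumes "\<And>s. 0 \<le> s \<Longrightarrow> compact (C s)" "\<And>s t. 0 \<le> s \<Longrightarrow> s \<le> t \<Longrightarrow> C t \<subseteq> C s"
    and "open U" "(\<Inter>s\<in>{0..}. C s) \<subseteq> U"
  shows "\<exists>s\<ge>0. C s \<subseteq> U"
proof (rule ccontr)
  assume "\<not> (\<exists>s\<ge>0. C s \<subseteq> U)"
  then have ne: "C (real n) - U \<noteq> {}" for n :: nat by auto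
  have "(\<Inter>n. C (real n) - U) \<noteq> {}"
  proof (rule compact_nest)
    show "compact (C (real n) - U)" for n :: nat
      using assms by (intro compact_diff) auto
    show "C (real n) - U \<subseteq> C (real m) - U" if "m \<le> n" for m n :: nat
      using assms(2)[of "real m" "real n"] that by auto
  qed (rule ne)
  then obtain x where x: "x \<notin> U" "\<And>n :: nat. x \<in> C (real n)" by auto
  have "x \<in> C s" if "0 \<le> s" for s
    using x(2) assms(2)[OF that] real_arch_simple[of s] by blast
  then show False using x assms(4) by auto
qed

text \<open>Forward invariance makes the images of \<open>K\<close> decrease with time. Hence the
  union over all times from \<open>s\<close> on is just the image at time \<open>s\<close>, which is
  already closed, and the closures in \<open>omega_limit\<close> disappear.\<close>

lemma omega_limit_attracts:
  fixes F :: "real \<Rightarrow> 'a::heine_borel \<Rightarrow> 'a"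
  assumes "\<forall>t\<ge>0. continuous_on K (F t)"
    and "\<forall>s\<ge>0. \<forall>t\<ge>0. \<forall>z\<in>K. F (t + s) z = F t (F s z)"
    and K: "compact K" "K \<noteq> {}" "K \<subseteq> Z" "forward_invariant F K"
    and top: "Metric_space.mtopology Z d = top_of_set Z"
  defines "\<A> \<equiv> omega_limit Z d F K"
  shows "\<A> \<noteq> {}" and "compact \<A>" and "\<A> \<subseteq> K" and "\<And>t. 0 \<le> t \<Longrightarrow> F t ` \<A> = \<A>"
    and "\<And>U. open U \<Longrightarrow> \<A> \<subseteq> U \<Longrightarrow> \<exists>s\<ge>0. \<forall>t\<ge>s. F t ` K \<subseteq> U"
proof -
  have cont: "continuous_on K (F t)" if "0 \<le> t" for t
    using assms(1) that by blast
  have add: "F (t + s) z = F t (F s z)" if "0 \<le> s" "0 \<le> t" "z \<in> K" for s t z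
    using assms(2) that by blast
  have inv: "F t ` K \<subseteq> K" if "0 \<le> t" for t
    using K(4) that by (simp add: forward_invariant_def)
  have comp: "compact (F s ` K)" if "0 \<le> s" for s
    using cont[OF that] K(1) by (rule compact_continuous_image)
  have image_add: "F (t + s) ` K = F t ` F s ` K" if "0 \<le> s" "0 \<le> t" for s t
    using add that by (force simp: image_image)
  have mono: "F t ` K \<subseteq> F s ` K" if "0 \<le> s" "s \<le> t" for s t
  proof -
    have "F t ` K = F s ` F (t - s) ` K" using image_add[of "t - s" s] that by simp
    also have "\<dots> \<subseteq> F s ` K" using inv[of "t - s"] that by (intro image_mono) simp
    finally show ?thesis .
  qed
  have "Metric_space.mtopology Z d closure_of (\<Union>t\<in>{s..}. F t ` K) = F s ` K" if "0 \<le> s" for s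
  proof -
    have "(\<Union>t\<in>{s..}. F t ` K) = F s ` K" using mono that by blast
    moreover have "closedin (top_of_set Z) (F s ` K)"
      using comp[OF that] inv[OF that] K(3)
      by (intro closed_subset) (auto simp: compact_imp_closed)
    ultimately show ?thesis by (simp add: top closure_of_closedin)
  qed
  then have \<A>: "\<A> = (\<Inter>s\<in>{0..}. F s ` K)" by (simp add: \<A>_def omega_limit_def)
  show attr: "\<exists>s\<ge>0. \<forall>t\<ge>s. F t ` K \<subseteq> U" if "open U" "\<A> \<subseteq> U" for U
  proof -
    have "\<exists>s\<ge>0. F s ` K \<subseteq> U"
      by (rule compact_nested_subset_open[OF comp mono that(1)]) (use that(2) \<A> in auto)
    then obtain s where "0 \<le> s" "F s ` K \<subseteq> U" by blast
    then show ?thesis using mono by (meson order_trans)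
  qed
  show "\<A> \<noteq> {}"
    \<comment> \<open>An empty limit set would lie in the open set \<open>{}\<close>, which would
      then have to contain a later image of the nonempty \<open>K\<close>.\<close>
    using attr[of "{}"] K(2) by auto
  show "\<A> \<subseteq> K" using inv[of 0] \<A> by auto
  show "compact \<A>"
  proof -
    have "closed \<A>" unfolding \<A> by (intro closed_INT ballI compact_imp_closed comp) simp
    then have "compact (K \<inter> \<A>)" using K(1) by (rule compact_Int_closed[rotated])
    then show ?thesis using \<open>\<A> \<subseteq> K\<close> by (simp add: Int_absorb1)
  qed
  fix t :: real assume t: "0 \<le> t"
  show "F t ` \<A> = \<A>"
  proof
    show "F t ` \<A> \<subseteq> \<A>"
    proof
      fix y assume "y \<in> F t ` \<A>"
      then obtain x where x: "x \<in> \<A>" "y = F t x" by blast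
      have "y \<in> F s ` K" if "0 \<le> s" for s
      proof -
        have "y \<in> F (t + s) ` K" using x \<A> that t image_add[OF that t] by auto
        then show ?thesis using mono[of s "t + s"] that t by auto
      qed
      then show "y \<in> \<A>" by (simp add: \<A>)
    qed
    show "\<A> \<subseteq> F t ` \<A>"
    proof
      fix x assume x: "x \<in> \<A>"
      \<comment> \<open>If no preimage of \<open>x\<close> lay in \<open>\<A>\<close>, then by compactness \<open>x\<close> would have no preimage in some \<open>F s ` K\<close>.\<close>
      show "x \<in> F t ` \<A>"
      proof (rule ccontr)
        assume "x \<notin> F t ` \<A>"
        define C where "C s = F s ` K \<inter> (K \<inter> F t -` {x})" for s
        have "closed (K \<inter> F t -` {x})"
          using cont[OF t] K(1) by (intro continuous_closed_preimage) (auto simp: compact_imp_closed)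
        then have "compact (C s)" if "0 \<le> s" for s
          unfolding C_def using comp[OF that] by (intro compact_Int_closed)
        moreover have "C b \<subseteq> C a" if "0 \<le> a" "a \<le> b" for a b
          using mono[OF that] by (auto simp: C_def)
        moreover have "(\<Inter>s\<in>{0..}. C s) \<subseteq> {}"
          using \<open>x \<notin> F t ` \<A>\<close> by (auto simp: C_def \<A>)
        ultimately have "\<exists>s\<ge>0. C s \<subseteq> {}"
          by (intro compact_nested_subset_open) auto
        then obtain s where s: "0 \<le> s" "C s = {}" by auto
        have "x \<in> F (t + s) ` K" using x s(1) t by (auto simp: \<A>)
        then obtain z where "z \<in> F s ` K" "x = F t z" using image_add[OF s(1) t] by auto
        then have "z \<in> C s" using inv[OF s(1)] by (auto simp: C_def)
        then show False using s by simp
      qed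
    qed
  qed
qed

lemma global_attractorI:
  assumes "Metric_space Z d"
    and "\<And>t. 0 \<le> t \<Longrightarrow> F t \<in> Z \<rightarrow> Z" "\<A> \<noteq> {}"
    and "compactin (Metric_space.mtopology Z d) \<A>"
    and "\<And>t. 0 \<le> t \<Longrightarrow> F t ` \<A> = \<A>"
    and attr: "\<And>B e. Metric_space.mbounded Z d B \<Longrightarrow> 0 < e \<Longrightarrow>
      \<exists>T. \<forall>t\<ge>T. \<forall>x\<in>B. \<exists>y\<in>\<A>. d (F t x) y \<le> e"
  shows "global_attractor Z d F \<A>"
  unfolding global_attractor_def
proof (intro conjI allI impI assms(2,3,4,5))
  fix B assume B: "Metric_space.mbounded Z d B"
  show "((\<lambda>t. SUP x\<in>B. INF y\<in>\<A>. ennreal (d (F t x) y)) \<longlongrightarrow> 0) at_top"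
  proof (rule order_tendstoI)
    fix a :: ennreal assume "0 < a"
    \<comment> \<open>The estimate of the supremum is not strict, but the limit asks for a value
      strictly below \<open>a\<close>; the intermediate \<open>b\<close> makes room. It is also
      finite when \<open>a\<close> is not, so that it comes from a real \<open>e\<close>.\<close>
    then obtain b where b: "0 < b" "b < a" using dense by blast
    then have "b < top" using order_less_le_trans by (metis top_greatest)
    then obtain e where e: "b = ennreal e" "0 < e"
      using b by (cases b) auto
    obtain T where T: "\<And>t x. T \<le> t \<Longrightarrow> x \<in> B \<Longrightarrow> \<exists>y\<in>\<A>. d (F t x) y \<le> e"
      using attr[OF B e(2)] by blast
    have "(SUP x\<in>B. INF y\<in>\<A>. ennreal (d (F t x) y)) \<le> b" if t: "T \<le> t" for t
    proof (rule SUP_least)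
      fix x assume "x \<in> B"
      then obtain y where "y \<in> \<A>" "d (F t x) y \<le> e" using T[OF t] by blast
      then show "(INF y\<in>\<A>. ennreal (d (F t x) y)) \<le> b"
        unfolding e(1) by (intro INF_lower2[of y] ennreal_leI)
    qed
    then show "\<forall>\<^sub>F t in at_top. (SUP x\<in>B. INF y\<in>\<A>. ennreal (d (F t x) y)) < a"
      unfolding eventually_at_top_linorder using b(2) le_less_trans by blast
  qed simp
qed

section \<open>The invariant law\<close>

declare transpose_matrix_vector [simp del]

lemma is_generator_row_sum:
  assumes "is_generator q"
  shows "(\<Sum>j\<in>UNIV. q $ i $ j) = 0"
  using assms by (simp add: is_generator_def sum.remove[of UNIV i])

text \<open>Conservation of mass: after swapping the sums, the coordinate sum of the image is a
  combination of the row sums of \<open>q\<close>, which vanish.\<close>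

lemma transpose_generator_mult_zero_sum:
  assumes "is_generator q"
  shows "transpose q *v x \<in> zero_sum"
proof -
  have "(\<Sum>j\<in>UNIV. (transpose q *v x) $ j) = (\<Sum>i\<in>UNIV. \<Sum>j\<in>UNIV. q $ i $ j * x $ i)"
    unfolding matrix_vector_mult_def transpose_def by simp (rule sum.swap)
  also have "\<dots> = 0"
    by (simp add: is_generator_row_sum[OF assms] flip: sum_distrib_right)
  finally show ?thesis by (simp add: zero_sum_def)
qed

text \<open>In each coordinate the kernel equation isolates the nonpositive diagonal term. Taking
  absolute values and using the triangle inequality on the nonnegative off-diagonal part shows that
  every coordinate of the new image is nonnegative; since they sum to 0, all of them vanish.\<close>

lemma transpose_generator_mult_abs:
  assumes q: "is_generator q" and ker: "transpose q *v x = 0"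
  shows "transpose q *v (\<chi> i. \<bar>x $ i\<bar>) = 0"
proof -
  let ?y = "\<chi> i. \<bar>x $ i\<bar>"
  have nonneg: "0 \<le> (transpose q *v ?y) $ j" for j
  proof -
    have split: "(transpose q *v z) $ j = q $ j $ j * z $ j + (\<Sum>i\<in>UNIV - {j}. q $ i $ j * z $ i)" for z
      by (simp add: matrix_vector_mult_def transpose_def sum.remove[of UNIV j])
    have diag: "q $ j $ j \<le> 0"
      using q unfolding is_generator_def by (metis DiffD2 neg_le_0_iff_le singletonI sum_nonneg)
    have "- (q $ j $ j * \<bar>x $ j\<bar>) = \<bar>q $ j $ j * x $ j\<bar>"
      using diag by (simp add: abs_mult)
    also have "\<dots> = \<bar>\<Sum>i\<in>UNIV - {j}. q $ i $ j * x $ i\<bar>"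
      using split[of x] ker by (simp add: add_eq_0_iff)
    also have "\<dots> \<le> (\<Sum>i\<in>UNIV - {j}. \<bar>q $ i $ j * x $ i\<bar>)"
      by (rule sum_abs)
    also have "\<dots> = (\<Sum>i\<in>UNIV - {j}. q $ i $ j * \<bar>x $ i\<bar>)"
      using q by (intro sum.cong) (auto simp: is_generator_def abs_mult)
    finally show ?thesis by (simp add: split)
  qed
  moreover have "(\<Sum>j\<in>UNIV. (transpose q *v ?y) $ j) = 0"
    using transpose_generator_mult_zero_sum[OF q] by (simp add: zero_sum_def)
  ultimately show ?thesis
    by (simp add: sum_nonneg_eq_0_iff vec_eq_iff)
qed

section \<open>The matrix exponential and the operator norm\<close>

lemma bounded_bilinear_matrix_mult:
  "bounded_bilinear ((**) :: real ^ 'n ^ 'n \<Rightarrow> real ^ 'n ^ 'n \<Rightarrow> real ^ 'n ^ 'n)"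
proof -
  have 1: "linear ((**) x)" for x :: "real ^ 'n ^ 'n"
    by (rule linearI)
     (simp_all add: vec_eq_iff matrix_matrix_mult_def distrib_left sum.distrib
        sum_distrib_left mult.left_commute)
  have 2: "linear (\<lambda>x. x ** y)" for y :: "real ^ 'n ^ 'n"
    by (rule linearI)
     (simp_all add: vec_eq_iff matrix_matrix_mult_def distrib_right sum.distrib
        sum_distrib_left mult.assoc)
  have "bilinear ((**) :: real ^ 'n ^ 'n \<Rightarrow> real ^ 'n ^ 'n \<Rightarrow> real ^ 'n ^ 'n)"
    unfolding bilinear_def using 1 2 by blast
  then show ?thesis
    by (simp only: bilinear_conv_bounded_bilinear)
qed

text \<open>Bilinearity bounds the norm of a product only up to a factor \<open>K\<close>, so the
  terms are compared with the real exponential series of \<open>norm A * K\<close>.\<close>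

lemma summable_mat_exp:
  fixes A :: "real ^ 'n ^ 'n"
  shows "summable (\<lambda>k. (1 / fact k) *\<^sub>R (((**) A ^^ k) (mat 1 :: real ^ 'n ^ 'n)))"
proof -
  have "\<exists>K>0. \<forall>(A :: real ^ 'n ^ 'n) (B :: real ^ 'n ^ 'n). norm (A ** B) \<le> norm A * norm B * K"
    by (rule bounded_bilinear.pos_bounded[OF bounded_bilinear_matrix_mult])
  then obtain K where K: "0 < K" "\<forall>(A :: real ^ 'n ^ 'n) (B :: real ^ 'n ^ 'n). norm (A ** B) \<le> norm A * norm B * K"
    by (elim exE conjE)
  have power_bound: "norm (((**) A ^^ k) (mat 1)) \<le> norm (mat 1 :: real ^ 'n ^ 'n) * (norm A * K) ^ k" for k
  proof (induction k)
    case (Suc k)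
    have "norm (((**) A ^^ Suc k) (mat 1)) \<le> norm (((**) A ^^ k) (mat 1)) * (norm A * K)"
      using K(2)[rule_format, of A "((**) A ^^ k) (mat 1)"] by (simp add: mult_ac)
    also have "\<dots> \<le> norm (mat 1 :: real ^ 'n ^ 'n) * (norm A * K) ^ k * (norm A * K)"
      using Suc K by (intro mult_right_mono) auto
    finally show ?case by (simp add: mult_ac)
  qed simp
  show ?thesis
  proof (rule summable_comparison_test)
    show "summable (\<lambda>k. norm (mat 1 :: real ^ 'n ^ 'n) * (inverse (fact k) * (norm A * K) ^ k))"
      by (intro summable_mult summable_exp)
    show "\<exists>N. \<forall>k\<ge>N. norm ((1 / fact k) *\<^sub>R ((**) A ^^ k) (mat 1)) \<le> norm (mat 1 :: real ^ 'n ^ 'n) * (inverse (fact k) * (norm A * K) ^ k)"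
      using power_bound by (auto simp: field_simps)
  qed
qed

text \<open>Evaluation at \<open>x\<close> is bounded linear and passes through the series, of which
  only the term of order 0 survives.\<close>

lemma mat_exp_mult_kernel:
  fixes A :: "real ^ 'n ^ 'n"
  assumes "A *v x = 0"
  shows "mat_exp A *v x = x"
proof -
  have pow: "((**) A ^^ k) (mat 1) *v x = (if k = 0 then x else 0)" for k
    by (induction k) (auto simp: assms simp flip: matrix_vector_mul_assoc)
  have "linear (\<lambda>B :: real ^ 'n ^ 'n. B *v x)"
    by (intro linearI) (auto simp: matrix_vector_mult_add_rdistrib scaleR_matrix_vector_assoc)
  then have "bounded_linear (\<lambda>B :: real ^ 'n ^ 'n. B *v x)"
    by (simp add: linear_conv_bounded_linear)
  then have "mat_exp A *v x = (\<Sum>k. ((1 / fact k) *\<^sub>R ((**) A ^^ k) (mat 1)) *v x)"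
    unfolding mat_exp_def by (rule bounded_linear.suminf[OF _ summable_mat_exp])
  also have "\<dots> = (\<Sum>k. if k = 0 then x else 0)"
    by (intro suminf_cong) (auto simp: pow simp flip: scaleR_matrix_vector_assoc)
  also have "\<dots> = x"
    by (subst suminf_finite[of "{0}"]) auto
  finally show ?thesis .
qed

text \<open>The point is that the quotients in \<open>opnorm1\<close> are bounded above: only then
  does their \<open>SUP\<close> dominate each of them.\<close>

lemma norm1_mult_le_opnorm1: "norm1 (A *v x) \<le> opnorm1 A * norm1 x"
proof (cases "norm1 x = 0")
  case False
  then have "0 < norm1 x" using norm1_nonneg[of x] by simp
  obtain K where K: "\<And>x. norm (A *v x) \<le> norm x * K"
    using bounded_linear.bounded[OF matrix_vector_mul_bounded_linear[of A]] by blast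
  have "norm1 (A *v x) / norm1 x \<le> real CARD('a) * \<bar>K\<bar>" for x
  proof (cases "norm1 x = 0")
    case False
    have "norm1 (A *v x) \<le> real CARD('a) * norm (A *v x)" by (rule norm1_le_norm)
    also have "norm (A *v x) \<le> norm1 x * \<bar>K\<bar>"
      using K[of x] norm_le_norm1[of x]
      by (smt (verit) mult_left_mono mult_right_mono norm_ge_zero)
    finally show ?thesis using False norm1_nonneg[of x] by (simp add: divide_le_eq mult_ac)
  qed simp
  then have "bdd_above (range (\<lambda>x. norm1 (A *v x) / norm1 x))" by (auto simp: bdd_above_def)
  then have "norm1 (A *v x) / norm1 x \<le> opnorm1 A"
    unfolding opnorm1_def by (rule cSUP_upper[OF UNIV_I])
  then show ?thesis using \<open>0 < norm1 x\<close> by (simp add: divide_le_eq)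
qed (simp add: norm1_eq_0, simp add: norm1_def)

lemma actor_box_eq_cbox: "actor_box R = cbox (\<chi> _. - R) (\<chi> _. R)"
  by (auto simp: actor_box_def mem_box_cart)

lemma compact_actor_box: "compact (actor_box R)"
  by (simp add: actor_box_eq_cbox)

lemma subspace_zero_sum: "subspace zero_sum"
  by (auto simp: subspace_def zero_sum_def sum.distrib simp flip: sum_distrib_left)

lemma simplex_S_norm_le_1: "\<mu> \<in> simplex_S \<Longrightarrow> norm \<mu> \<le> 1"
  using norm_le_norm1[of \<mu>] by (simp add: simplex_S_def norm1_def)

section \<open>Existence, uniqueness and Lipschitz dependence of the invariant law\<close>

locale mixing_generators =
  fixes \<Theta> :: "(real ^ 'd) set" and Q :: "real ^ 'd \<Rightarrow> real ^ 'n ^ 'n"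
  assumes compact: "compact \<Theta>"
    and generator: "\<And>\<theta>. \<theta> \<in> \<Theta> \<Longrightarrow> is_generator (Q \<theta>)"
    and Lipschitz: "\<exists>L. \<forall>\<theta>\<in>\<Theta>. \<forall>\<theta>'\<in>\<Theta>. opnorm1 (transpose (Q \<theta>) - transpose (Q \<theta>')) \<le> L * norm (\<theta> - \<theta>')"
    and mixing: "\<exists>C \<gamma>. 0 < \<gamma> \<and> (\<forall>\<theta>\<in>\<Theta>. \<forall>\<xi>\<in>zero_sum. \<forall>t\<ge>0.
      norm1 (mat_exp (t *\<^sub>R transpose (Q \<theta>)) *v \<xi>) \<le> C * exp (- \<gamma> * t) * norm1 \<xi>)"
begin

lemma kernel_zero_sum:
  assumes \<theta>: "\<theta> \<in> \<Theta>" and \<xi>: "\<xi> \<in> zero_sum" "transpose (Q \<theta>) *v \<xi> = 0"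
  shows "\<xi> = 0"
proof -
  obtain C \<gamma> where \<gamma>: "0 < \<gamma>" and C: "\<And>t. 0 \<le> t \<Longrightarrow>
      norm1 (mat_exp (t *\<^sub>R transpose (Q \<theta>)) *v \<xi>) \<le> C * exp (- \<gamma> * t) * norm1 \<xi>"
    using mixing \<theta> \<xi>(1) by meson
  have "mat_exp (t *\<^sub>R transpose (Q \<theta>)) *v \<xi> = \<xi>" for t
    by (rule mat_exp_mult_kernel) (simp add: \<xi>(2) flip: scaleR_matrix_vector_assoc)
  then have le: "norm1 \<xi> \<le> C * exp (- \<gamma> * t) * norm1 \<xi>" if "0 \<le> t" for t
    using C[OF that] by simp
  have "((\<lambda>t. exp (- (\<gamma> * t))) \<longlongrightarrow> 0) at_top"
    using \<gamma> by (intro filterlim_compose[OF exp_at_bot]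
        filterlim_compose[OF filterlim_uminus_at_bot_at_top] filterlim_tendsto_pos_mult_at_top[OF tendsto_const])
      (auto intro: filterlim_ident)
  then have "((\<lambda>t. C * exp (- \<gamma> * t) * norm1 \<xi>) \<longlongrightarrow> C * 0 * norm1 \<xi>) at_top"
    by (intro tendsto_intros) simp
  then have "norm1 \<xi> \<le> C * 0 * norm1 \<xi>"
    by (rule tendsto_le[OF _ _ tendsto_const, rotated]) (use le in \<open>auto intro!: eventually_at_top_linorderI[of 0]\<close>)
  then show ?thesis using norm1_nonneg[of \<xi>] norm1_eq_0[of \<xi>] by simp
qed

text \<open>\<open>Q\<^sup>*\<close> maps \<open>zero_sum\<close> bijectively to itself, which yields a kernel vector with coordinate
  sum \<open>1\<close>; its coordinatewise absolute value lies in the kernel too, hence is a multiple of it.\<close>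

lemma invariant_law_ex1:
  assumes \<theta>: "\<theta> \<in> \<Theta>"
  shows "\<exists>!\<mu>. \<mu> \<in> simplex_S \<and> transpose (Q \<theta>) *v \<mu> = 0"
proof (rule ex_ex1I)
  let ?M = "transpose (Q \<theta>)"
  note gen = generator[OF \<theta>]
  have "inj_on ((*v) ?M) zero_sum"
  proof (rule inj_onI)
    fix x y assume xy: "x \<in> zero_sum" "y \<in> zero_sum" "?M *v x = ?M *v y"
    then have "x - y \<in> zero_sum" using subspace_diff[OF subspace_zero_sum] by blast
    moreover have "?M *v (x - y) = 0" using xy by (simp add: matrix_vector_mult_diff_distrib)
    ultimately have "x - y = 0" by (rule kernel_zero_sum[OF \<theta>])
    then show "x = y" by simp
  qed
  then have "dim ((*v) ?M ` zero_sum) = dim (zero_sum :: (real ^ 'n) set)"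
    using subspace_zero_sum
    by (intro dim_image_eq) (auto simp: span_eq_iff[THEN iffD2, OF subspace_zero_sum])
  then have surj: "(*v) ?M ` zero_sum = zero_sum"
    using transpose_generator_mult_zero_sum[OF gen] subspace_zero_sum
    by (intro subspace_dim_equal) (auto intro: linear_subspace_image)
  \<comment> \<open>Any vector with coordinate sum 1 would do: subtracting a zero-sum vector with
    the same image moves it into the kernel and keeps the sum.\<close>
  define u :: "real ^ 'n" where "u = (\<chi> _. 1 / real CARD('n))"
  have u: "(\<Sum>i\<in>UNIV. u $ i) = 1" by (simp add: u_def)
  obtain \<xi> where \<xi>: "\<xi> \<in> zero_sum" "?M *v u = ?M *v \<xi>"
    using transpose_generator_mult_zero_sum[OF gen, of u] surj by (metis imageE)
  define \<mu> where "\<mu> = u - \<xi>"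
  have \<mu>: "(\<Sum>i\<in>UNIV. \<mu> $ i) = 1" "?M *v \<mu> = 0"
    using \<xi> u by (auto simp: \<mu>_def zero_sum_def sum_subtractf matrix_vector_mult_diff_distrib)
  define \<nu> where "\<nu> = (\<chi> i. \<bar>\<mu> $ i\<bar>)"
  define s where "s = (\<Sum>i\<in>UNIV. \<bar>\<mu> $ i\<bar>)"
  have s: "1 \<le> s" using \<mu>(1) sum_abs[of "\<lambda>i. \<mu> $ i" UNIV] by (simp add: s_def)
  \<comment> \<open>Both vectors lie in the kernel and have coordinate sum \<open>s\<close>, so
    injectivity on \<open>zero_sum\<close> identifies them. As \<open>s\<close> is positive, a
    coordinate of \<open>\<mu>\<close> then has the sign of its absolute value.\<close>
  have "\<nu> - s *\<^sub>R \<mu> = 0"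
  proof (rule kernel_zero_sum[OF \<theta>])
    show "\<nu> - s *\<^sub>R \<mu> \<in> zero_sum"
      using \<mu>(1) by (simp add: zero_sum_def \<nu>_def s_def sum_subtractf flip: sum_distrib_left)
    show "?M *v (\<nu> - s *\<^sub>R \<mu>) = 0"
      using \<mu>(2) transpose_generator_mult_abs[OF gen \<mu>(2)]
      by (simp add: \<nu>_def matrix_vector_mult_diff_distrib matrix_vector_mult_scaleR)
  qed
  then have "\<bar>\<mu> $ i\<bar> = s * \<mu> $ i" for i
    by (auto simp: \<nu>_def vec_eq_iff)
  then have "0 \<le> \<mu> $ i" for i
    using s by (metis abs_ge_zero zero_le_mult_iff not_one_le_zero order_trans)
  then show "\<exists>\<mu>. \<mu> \<in> simplex_S \<and> ?M *v \<mu> = 0"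
    using \<mu> by (auto simp: simplex_S_def)
  fix \<mu>1 \<mu>2 assume "\<mu>1 \<in> simplex_S \<and> ?M *v \<mu>1 = 0" "\<mu>2 \<in> simplex_S \<and> ?M *v \<mu>2 = 0"
  then have "\<mu>1 - \<mu>2 \<in> zero_sum" "?M *v (\<mu>1 - \<mu>2) = 0"
    by (simp_all add: zero_sum_def simplex_S_def sum_subtractf matrix_vector_mult_diff_distrib)
  then have "\<mu>1 - \<mu>2 = 0" by (rule kernel_zero_sum[OF \<theta>])
  then show "\<mu>1 = \<mu>2" by simp
qed

lemma
  assumes "\<theta> \<in> \<Theta>"
  shows invariant_law_mem: "invariant_law Q \<theta> \<in> simplex_S"
    and invariant_law_kernel: "transpose (Q \<theta>) *v invariant_law Q \<theta> = 0"
  using theI'[OF invariant_law_ex1[OF assms]] by (auto simp: invariant_law_def)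

text \<open>The factor \<open>norm \<xi>\<close> stays explicit because the estimate is used twice:
  at basis vectors for continuity, and at an invariant law, whose norm is at most 1, for a constant
  independent of the law.\<close>

lemma transpose_mult_lipschitz:
  obtains L where "\<And>\<xi>. (L * norm \<xi>)-lipschitz_on \<Theta> (\<lambda>\<theta>. transpose (Q \<theta>) *v \<xi>)"
proof -
  obtain L where L: "\<And>\<theta> \<theta>'. \<theta> \<in> \<Theta> \<Longrightarrow> \<theta>' \<in> \<Theta> \<Longrightarrow> opnorm1 (transpose (Q \<theta>) - transpose (Q \<theta>')) \<le> L * norm (\<theta> - \<theta>')"
    using Lipschitz by blast
  have "norm (transpose (Q \<theta>) *v \<xi> - transpose (Q \<theta>') *v \<xi>) \<le> \<bar>L\<bar> * real CARD('n) * norm \<xi> * norm (\<theta> - \<theta>')"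
    if "\<theta> \<in> \<Theta>" "\<theta>' \<in> \<Theta>" for \<theta> \<theta>' \<xi>
  proof -
    have "norm (transpose (Q \<theta>) *v \<xi> - transpose (Q \<theta>') *v \<xi>) \<le> norm1 ((transpose (Q \<theta>) - transpose (Q \<theta>')) *v \<xi>)"
      by (metis norm_le_norm1 matrix_vector_mult_diff_rdistrib)
    also have "\<dots> \<le> opnorm1 (transpose (Q \<theta>) - transpose (Q \<theta>')) * norm1 \<xi>"
      by (rule norm1_mult_le_opnorm1)
    also have "\<dots> \<le> (\<bar>L\<bar> * norm (\<theta> - \<theta>')) * norm1 \<xi>"
      by (intro mult_right_mono norm1_nonneg order_trans[OF L[OF that]]) auto
    also have "\<dots> \<le> (\<bar>L\<bar> * norm (\<theta> - \<theta>')) * (real CARD('n) * norm \<xi>)"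
      by (intro mult_left_mono norm1_le_norm) auto
    finally show ?thesis by (simp add: mult_ac)
  qed
  then show thesis
    by (intro that[of "\<bar>L\<bar> * real CARD('n)"] lipschitz_onI) (auto simp: dist_norm)
qed

text \<open>On pairs of a parameter and a zero-sum unit vector the norm of the image is continuous
  and has no zero, so it attains a positive minimum; homogeneity does the rest.\<close>

lemma transpose_mult_lower_bound:
  obtains c where "0 < c" "\<And>\<theta> \<xi>. \<theta> \<in> \<Theta> \<Longrightarrow> \<xi> \<in> zero_sum \<Longrightarrow> c * norm \<xi> \<le> norm (transpose (Q \<theta>) *v \<xi>)"
proof -
  define S where "S = \<Theta> \<times> (sphere 0 1 \<inter> zero_sum :: (real ^ 'n) set)"
  define g where "g p = norm (transpose (Q (fst p)) *v snd p)" for p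
  have S: "compact S"
    unfolding S_def using subspace_zero_sum
    by (intro compact_Times compact compact_Int_closed closed_subspace) auto
  obtain L where L: "\<And>\<xi>. (L * norm \<xi>)-lipschitz_on \<Theta> (\<lambda>\<theta>. transpose (Q \<theta>) *v \<xi>)"
    using transpose_mult_lipschitz by blast
  have "continuous_on S (\<lambda>p. transpose (Q (fst p)) *v snd p)"
  proof -
    \<comment> \<open>Expanding \<open>\<xi>\<close> in the basis reduces joint continuity to the
      continuity of each matrix column in the parameter.\<close>
    have expand: "transpose (Q \<theta>) *v \<xi> = (\<Sum>j\<in>UNIV. \<xi> $ j *\<^sub>R (transpose (Q \<theta>) *v axis j 1))" for \<theta> \<xi>
      by (simp only: matrix_vector_mult_basis) (simp add: matrix_mult_sum scalar_mult_eq_scaleR)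
    have "continuous_on S (\<lambda>p. transpose (Q (fst p)) *v axis j 1)" for j
      using lipschitz_on_continuous_on[OF L]
      by (rule continuous_on_compose2) (auto simp: S_def intro!: continuous_intros)
    then have "continuous_on S (\<lambda>p. \<Sum>j\<in>UNIV. snd p $ j *\<^sub>R (transpose (Q (fst p)) *v axis j 1))"
      by (intro continuous_intros)
    then show ?thesis
      by (rule continuous_on_eq) (rule expand[symmetric])
  qed
  then have g: "continuous_on S g" unfolding g_def by (intro continuous_intros)
  have "\<exists>c>0. \<forall>p\<in>S. c \<le> g p"
  \<comment> \<open>\<open>S\<close> is empty when there is a single state, since then
    \<open>zero_sum\<close> contains only 0; every positive \<open>c\<close> works in that
    case.\<close>
  proof (cases "S = {}")
    case False
    then obtain p where p: "p \<in> S" "\<And>q. q \<in> S \<Longrightarrow> g p \<le> g q"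
      using continuous_attains_inf[OF S _ g] by blast
    have "g p \<noteq> 0"
      using p(1) kernel_zero_sum[of "fst p" "snd p"] by (auto simp: S_def g_def)
    then have "0 < g p" by (simp add: g_def)
    then show ?thesis using p by blast
  qed (auto intro: exI[of _ 1])
  then obtain c where c: "0 < c" "\<And>p. p \<in> S \<Longrightarrow> c \<le> g p" by blast
  have "c * norm \<xi> \<le> norm (transpose (Q \<theta>) *v \<xi>)" if "\<theta> \<in> \<Theta>" "\<xi> \<in> zero_sum" for \<theta> \<xi>
  proof (cases "\<xi> = 0")
    case False
    have "(\<theta>, (1 / norm \<xi>) *\<^sub>R \<xi>) \<in> S"
      using that False subspace_zero_sum by (auto simp: S_def intro!: subspace_scale)
    then have "c \<le> norm (transpose (Q \<theta>) *v \<xi>) / norm \<xi>"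
      using c(2) by (fastforce simp: g_def matrix_vector_mult_scaleR)
    then show ?thesis using False by (simp add: field_simps)
  qed simp
  then show thesis using that c(1) by blast
qed

text \<open>Both laws are annihilated by their own generators, so applying the generator at
  \<open>\<theta>\<close> to their difference leaves only the change of generator acting on the
  second law. The uniform lower bound converts this into an estimate of the difference
  itself.\<close>

lemma invariant_law_lipschitz: "\<exists>L. L-lipschitz_on \<Theta> (invariant_law Q)"
proof -
  obtain c where c: "0 < c" "\<And>\<theta> \<xi>. \<theta> \<in> \<Theta> \<Longrightarrow> \<xi> \<in> zero_sum \<Longrightarrow> c * norm \<xi> \<le> norm (transpose (Q \<theta>) *v \<xi>)"
    using transpose_mult_lower_bound by blast
  obtain L where L: "\<And>\<xi>. (L * norm \<xi>)-lipschitz_on \<Theta> (\<lambda>\<theta>. transpose (Q \<theta>) *v \<xi>)"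
    using transpose_mult_lipschitz by blast
  have "norm (invariant_law Q \<theta> - invariant_law Q \<theta>') \<le> \<bar>L\<bar> / c * norm (\<theta> - \<theta>')"
    if \<theta>: "\<theta> \<in> \<Theta>" "\<theta>' \<in> \<Theta>" for \<theta> \<theta>'
  proof -
    let ?\<mu> = "invariant_law Q \<theta>" and ?\<mu>' = "invariant_law Q \<theta>'"
    have "?\<mu> - ?\<mu>' \<in> zero_sum"
      using invariant_law_mem[OF \<theta>(1)] invariant_law_mem[OF \<theta>(2)]
      by (simp add: zero_sum_def simplex_S_def sum_subtractf)
    then have "c * norm (?\<mu> - ?\<mu>') \<le> norm (transpose (Q \<theta>) *v (?\<mu> - ?\<mu>'))"
      by (rule c(2)[OF \<theta>(1)])
    also have "\<dots> = norm (transpose (Q \<theta>') *v ?\<mu>' - transpose (Q \<theta>) *v ?\<mu>')"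
      using invariant_law_kernel[OF \<theta>(1)] invariant_law_kernel[OF \<theta>(2)]
      by (simp add: matrix_vector_mult_diff_distrib)
    also have "\<dots> \<le> L * norm ?\<mu>' * norm (\<theta>' - \<theta>)"
      using lipschitz_on_normD[OF L \<theta>(2,1)] .
    also have "\<dots> \<le> \<bar>L\<bar> * 1 * norm (\<theta>' - \<theta>)"
      using simplex_S_norm_le_1[OF invariant_law_mem[OF \<theta>(2)]]
      by (intro mult_right_mono mult_mono) auto
    finally show ?thesis using c(1) by (simp add: field_simps norm_minus_commute)
  qed
  then show ?thesis
    using c(1) by (intro exI[of _ "\<bar>L\<bar> / c"] lipschitz_onI) (auto simp: dist_norm)
qed

end

section \<open>Bounded Lipschitz functions\<close>

text \<open>Products of Lipschitz functions are Lipschitz only when the factors are bounded.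
  Carrying both properties gives a class that is closed under all operations from which the field is
  built.\<close>

definition bounded_lipschitz_on :: "'a::metric_space set \<Rightarrow> ('a \<Rightarrow> 'b::metric_space) \<Rightarrow> bool" where
  "bounded_lipschitz_on S f \<longleftrightarrow> bounded (f ` S) \<and> (\<exists>L. L-lipschitz_on S f)"

lemma bounded_lipschitz_onI:
  fixes f :: "'a::metric_space \<Rightarrow> 'b::real_normed_vector"
  assumes "\<And>x. x \<in> S \<Longrightarrow> norm (f x) \<le> B"
    and "\<And>x y. x \<in> S \<Longrightarrow> y \<in> S \<Longrightarrow> norm (f x - f y) \<le> L * dist x y"
  shows "bounded_lipschitz_on S f"
proof -
  have "\<bar>L\<bar>-lipschitz_on S f"
  proof (rule lipschitz_onI)
    fix x y assume "x \<in> S" "y \<in> S"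
    then have "dist (f x) (f y) \<le> L * dist x y"
      using assms(2) by (simp add: dist_norm)
    also have "\<dots> \<le> \<bar>L\<bar> * dist x y"
      by (intro mult_right_mono) auto
    finally show "dist (f x) (f y) \<le> \<bar>L\<bar> * dist x y" .
  qed simp
  then show ?thesis
    using assms(1) by (auto simp: bounded_lipschitz_on_def bounded_iff)
qed

lemma bounded_lipschitz_onE:
  fixes f :: "'a::metric_space \<Rightarrow> 'b::real_normed_vector"
  assumes "bounded_lipschitz_on S f"
  obtains B L where "0 \<le> B" "0 \<le> L" "\<And>x. x \<in> S \<Longrightarrow> norm (f x) \<le> B"
    "\<And>x y. x \<in> S \<Longrightarrow> y \<in> S \<Longrightarrow> norm (f x - f y) \<le> L * dist x y"
proof -
  obtain L where "L-lipschitz_on S f" using assms by (auto simp: bounded_lipschitz_on_def)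
  moreover obtain B where "0 < B" "\<forall>x\<in>f ` S. norm x \<le> B"
    using assms bounded_pos unfolding bounded_lipschitz_on_def by blast
  ultimately show thesis
    using lipschitz_on_nonneg by (intro that[of B L]) (auto simp: lipschitz_on_def dist_norm)
qed

lemma bounded_lipschitz_on_const: "bounded_lipschitz_on S (\<lambda>_. c :: 'b::real_normed_vector)"
  by (rule bounded_lipschitz_onI[where B = "norm c" and L = 0]) auto

lemma bounded_lipschitz_on_lipschitz:
  fixes f :: "'a::metric_space \<Rightarrow> 'b::real_normed_vector"
  assumes "L-lipschitz_on S f" "bounded S"
  shows "bounded_lipschitz_on S f"
proof (cases "S = {}")
  case False
  then obtain x0 where x0: "x0 \<in> S" by blast
  obtain D where D: "\<And>x. x \<in> S \<Longrightarrow> dist x x0 \<le> D"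
    using assms(2) by (metis bounded_any_center dist_commute)
  have "norm (f x) \<le> norm (f x0) + L * D" if "x \<in> S" for x
  proof -
    have "norm (f x) \<le> norm (f x0) + norm (f x - f x0)" by norm
    also have "norm (f x - f x0) \<le> L * dist x x0"
      using lipschitz_onD[OF assms(1) that x0] by (simp add: dist_norm)
    also have "\<dots> \<le> L * D"
      using D[OF that] lipschitz_on_nonneg[OF assms(1)] by (intro mult_left_mono)
    finally show ?thesis by simp
  qed
  then show ?thesis
    using assms(1) by (intro bounded_lipschitz_onI) (auto simp: lipschitz_on_def dist_norm)
qed (auto simp: bounded_lipschitz_on_def intro: exI[of _ 0] lipschitz_onI)

lemma bounded_lipschitz_on_bounded_linear:
  assumes "bounded_linear g" "bounded_lipschitz_on S f"
  shows "bounded_lipschitz_on S (\<lambda>x. g (f x))"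
proof -
  obtain B L where f: "0 \<le> B" "0 \<le> L" "\<And>x. x \<in> S \<Longrightarrow> norm (f x) \<le> B"
    "\<And>x y. x \<in> S \<Longrightarrow> y \<in> S \<Longrightarrow> norm (f x - f y) \<le> L * dist x y"
    by (rule bounded_lipschitz_onE[OF assms(2)]) (rule that; blast)
  obtain K where K: "0 < K" "\<And>x. norm (g x) \<le> norm x * K"
    using bounded_linear.pos_bounded[OF assms(1)] by blast
  show ?thesis
  proof (rule bounded_lipschitz_onI)
    fix x assume "x \<in> S"
    then show "norm (g (f x)) \<le> B * K"
      using order_trans[OF K(2) mult_right_mono[OF f(3)]] K(1) by simp
  next
    fix x y assume "x \<in> S" "y \<in> S"
    then have "norm (f x - f y) * K \<le> L * dist x y * K"
      using f(4) K(1) by (intro mult_right_mono) auto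
    then show "norm (g (f x) - g (f y)) \<le> L * K * dist x y"
      using K(2)[of "f x - f y"] by (simp add: linear_diff[OF bounded_linear.linear[OF assms(1)]] mult_ac)
  qed
qed

lemma bounded_lipschitz_on_add:
  fixes f g :: "'a::metric_space \<Rightarrow> 'b::real_normed_vector"
  assumes "bounded_lipschitz_on S f" "bounded_lipschitz_on S g"
  shows "bounded_lipschitz_on S (\<lambda>x. f x + g x)"
proof -
  obtain B L where f: "0 \<le> B" "0 \<le> L" "\<And>x. x \<in> S \<Longrightarrow> norm (f x) \<le> B"
    "\<And>x y. x \<in> S \<Longrightarrow> y \<in> S \<Longrightarrow> norm (f x - f y) \<le> L * dist x y"
    by (rule bounded_lipschitz_onE[OF assms(1)]) (rule that; blast)
  obtain B' L' where g: "0 \<le> B'" "0 \<le> L'" "\<And>x. x \<in> S \<Longrightarrow> norm (g x) \<le> B'"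
    "\<And>x y. x \<in> S \<Longrightarrow> y \<in> S \<Longrightarrow> norm (g x - g y) \<le> L' * dist x y"
    by (rule bounded_lipschitz_onE[OF assms(2)]) (rule that; blast)
  show ?thesis
  proof (rule bounded_lipschitz_onI)
    fix x assume "x \<in> S"
    then show "norm (f x + g x) \<le> B + B'"
      using norm_triangle_mono[OF f(3) g(3)] by simp
  next
    fix x y assume "x \<in> S" "y \<in> S"
    then show "norm (f x + g x - (f y + g y)) \<le> (L + L') * dist x y"
      using norm_triangle_mono[OF f(4) g(4), of x y x y] by (simp add: algebra_simps)
  qed
qed

lemma bounded_lipschitz_on_minus:
  fixes f :: "'a::metric_space \<Rightarrow> 'b::real_normed_vector"
  shows "bounded_lipschitz_on S f \<Longrightarrow> bounded_lipschitz_on S (\<lambda>x. - f x)"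
  by (rule bounded_lipschitz_on_bounded_linear[OF bounded_linear_minus[OF bounded_linear_ident]])

lemma bounded_lipschitz_on_diff:
  fixes f g :: "'a::metric_space \<Rightarrow> 'b::real_normed_vector"
  assumes "bounded_lipschitz_on S f" "bounded_lipschitz_on S g"
  shows "bounded_lipschitz_on S (\<lambda>x. f x - g x)"
  using bounded_lipschitz_on_add[OF assms(1) bounded_lipschitz_on_minus[OF assms(2)]] by simp

lemma bounded_lipschitz_on_sum:
  fixes f :: "'i \<Rightarrow> 'a::metric_space \<Rightarrow> 'b::real_normed_vector"
  assumes "\<And>i. i \<in> I \<Longrightarrow> bounded_lipschitz_on S (f i)"
  shows "bounded_lipschitz_on S (\<lambda>x. \<Sum>i\<in>I. f i x)"
  using assms
  by (induction I rule: infinite_finite_induct)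
     (auto intro: bounded_lipschitz_on_const bounded_lipschitz_on_add)

lemma bounded_lipschitz_on_bilinear:
  assumes "bounded_bilinear p" "bounded_lipschitz_on S f" "bounded_lipschitz_on S g"
  shows "bounded_lipschitz_on S (\<lambda>x. p (f x) (g x))"
proof -
  interpret bounded_bilinear p by fact
  obtain B L where f: "0 \<le> B" "0 \<le> L" "\<And>x. x \<in> S \<Longrightarrow> norm (f x) \<le> B"
    "\<And>x y. x \<in> S \<Longrightarrow> y \<in> S \<Longrightarrow> norm (f x - f y) \<le> L * dist x y"
    by (rule bounded_lipschitz_onE[OF assms(2)]) (rule that; blast)
  obtain B' L' where g: "0 \<le> B'" "0 \<le> L'" "\<And>x. x \<in> S \<Longrightarrow> norm (g x) \<le> B'"
    "\<And>x y. x \<in> S \<Longrightarrow> y \<in> S \<Longrightarrow> norm (g x - g y) \<le> L' * dist x y"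
    by (rule bounded_lipschitz_onE[OF assms(3)]) (rule that; blast)
  obtain K where K: "0 < K" "\<And>a b. norm (p a b) \<le> norm a * norm b * K"
    using pos_bounded by blast
  show ?thesis
  proof (rule bounded_lipschitz_onI)
    fix x assume "x \<in> S"
    then have "norm (f x) * norm (g x) * K \<le> B * B' * K"
      using f g K by (intro mult_right_mono mult_mono) auto
    then show "norm (p (f x) (g x)) \<le> B * B' * K"
      using K(2) order_trans by blast
  next
    fix x y assume xy: "x \<in> S" "y \<in> S"
    have "p (f x) (g x) - p (f y) (g y) = p (f x - f y) (g x) + p (f y) (g x - g y)"
      by (simp add: diff_left diff_right)
    then have "norm (p (f x) (g x) - p (f y) (g y))
        \<le> norm (f x - f y) * norm (g x) * K + norm (f y) * norm (g x - g y) * K"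
      using norm_triangle_mono[OF K(2) K(2)] by simp
    also have "\<dots> \<le> (L * dist x y) * B' * K + B * (L' * dist x y) * K"
      using f g K xy by (intro add_mono mult_right_mono mult_mono) auto
    finally show "norm (p (f x) (g x) - p (f y) (g y)) \<le> (L * B' * K + B * L' * K) * dist x y"
      by (simp add: algebra_simps)
  qed
qed

lemmas bounded_lipschitz_on_mult = bounded_lipschitz_on_bilinear[OF bounded_bilinear_mult]
  and bounded_lipschitz_on_scaleR = bounded_lipschitz_on_bilinear[OF bounded_bilinear_scaleR]
  and bounded_lipschitz_on_inner = bounded_lipschitz_on_bilinear[OF bounded_bilinear_inner]

lemma bounded_lipschitz_on_Pair:
  fixes f :: "'a::metric_space \<Rightarrow> 'b::real_normed_vector" and g :: "'a \<Rightarrow> 'c::real_normed_vector"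
  assumes "bounded_lipschitz_on S f" "bounded_lipschitz_on S g"
  shows "bounded_lipschitz_on S (\<lambda>x. (f x, g x))"
proof -
  have "bounded_lipschitz_on S (\<lambda>x. (f x, 0 :: 'c) + (0 :: 'b, g x))"
    by (intro bounded_lipschitz_on_add
        bounded_lipschitz_on_bounded_linear[OF _ assms(1), of "\<lambda>x. (x, 0)"]
        bounded_lipschitz_on_bounded_linear[OF _ assms(2), of "\<lambda>x. (0, x)"]
        bounded_linear_Pair bounded_linear_ident bounded_linear_zero)
  then show ?thesis by simp
qed

lemma bounded_lipschitz_on_vec:
  fixes f :: "'a::metric_space \<Rightarrow> real ^ 'n"
  assumes "\<And>j. bounded_lipschitz_on S (\<lambda>x. f x $ j)"
  shows "bounded_lipschitz_on S f"
proof -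
  have "bounded_lipschitz_on S (\<lambda>x. \<Sum>j\<in>UNIV. (f x $ j) *\<^sub>R (axis j 1 :: real ^ 'n))"
    by (intro bounded_lipschitz_on_sum bounded_lipschitz_on_scaleR assms bounded_lipschitz_on_const)
  moreover have "(\<Sum>j\<in>UNIV. (v $ j) *\<^sub>R axis j 1) = v" for v :: "real ^ 'n"
    by (simp add: vec_eq_iff axis_def if_distrib cong: if_cong)
  ultimately show ?thesis by simp
qed

text \<open>The derivative has to be bounded only on a convex set that contains the values of
  \<open>f\<close>; this admits \<open>exp\<close> and \<open>ln\<close>, whose derivatives are
  unbounded on their whole domains.\<close>

lemma bounded_lipschitz_on_compose_real:
  fixes f :: "'a::metric_space \<Rightarrow> real" and g :: "real \<Rightarrow> real"
  assumes f: "bounded_lipschitz_on S f" "\<And>x. x \<in> S \<Longrightarrow> f x \<in> I"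
    and g: "convex I" "\<And>x. x \<in> I \<Longrightarrow> (g has_real_derivative g' x) (at x)"
      "\<And>x. x \<in> I \<Longrightarrow> \<bar>g' x\<bar> \<le> C"
  shows "bounded_lipschitz_on S (\<lambda>x. g (f x))"
proof -
  have "(max 0 C)-lipschitz_on I g"
  proof (rule bounded_derivative_imp_lipschitz)
    show "(g has_derivative (*) (g' x)) (at x within I)" if "x \<in> I" for x
      using g(2)[OF that] by (simp add: has_field_derivative_def has_derivative_at_withinI)
    show "onorm ((*) (g' x)) \<le> max 0 C" if "x \<in> I" for x
      using g(3)[OF that] by (intro onorm_le) (auto simp: abs_mult intro!: mult_right_mono)
  qed (use g in auto)
  then have lip: "(max 0 C)-lipschitz_on (f ` S) g"
    by (rule lipschitz_on_subset) (use f(2) in auto)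
  moreover have "bounded (g ` f ` S)"
    using bounded_lipschitz_on_lipschitz[OF lip] f(1) by (simp add: bounded_lipschitz_on_def)
  ultimately show ?thesis
    using f(1) lipschitz_on_compose[of _ S f _ g]
    by (force simp: bounded_lipschitz_on_def image_image o_def)
qed

lemma bounded_lipschitz_on_exp:
  assumes "bounded_lipschitz_on S f"
  shows "bounded_lipschitz_on S (\<lambda>x. exp (f x) :: real)"
proof -
  obtain B where "\<And>x. x \<in> S \<Longrightarrow> norm (f x) \<le> B"
    using assms by (elim bounded_lipschitz_onE) blast
  then show ?thesis
    by (intro bounded_lipschitz_on_compose_real[OF assms, of "{..B}" exp exp "exp B"]) fastforce+
qed

lemma bounded_lipschitz_on_ln:
  assumes "bounded_lipschitz_on S f" "0 < c" "\<And>x. x \<in> S \<Longrightarrow> c \<le> f x"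
  shows "bounded_lipschitz_on S (\<lambda>x. ln (f x) :: real)"
  using assms
  by (intro bounded_lipschitz_on_compose_real[OF assms(1), of "{c..}" ln inverse "inverse c"])
     (auto intro: DERIV_ln le_imp_inverse_le)

lemmas bounded_lipschitz_on_intros =
  bounded_lipschitz_on_const bounded_lipschitz_on_add bounded_lipschitz_on_diff
  bounded_lipschitz_on_sum bounded_lipschitz_on_mult bounded_lipschitz_on_scaleR
  bounded_lipschitz_on_inner

section \<open>The reduced vector field\<close>

lemma policy_pos: "0 < policy \<tau> \<psi> \<theta> i a"
  by (auto simp: policy_def intro!: divide_pos_pos sum_pos)

lemma sum_policy: "(\<Sum>a\<in>UNIV. policy \<tau> \<psi> \<theta> i a) = 1"
proof -
  have "0 < (\<Sum>b\<in>UNIV. exp ((\<psi> i b \<bullet> \<theta>) / \<tau>))" by (intro sum_pos) auto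
  then show ?thesis by (simp add: policy_def flip: sum_divide_distrib)
qed

lemma ln_policy: "ln (policy \<tau> \<psi> \<theta> i a) = (\<psi> i a \<bullet> \<theta>) / \<tau> - ln (\<Sum>b\<in>UNIV. exp ((\<psi> i b \<bullet> \<theta>) / \<tau>))"
proof -
  have "0 < (\<Sum>b\<in>UNIV. exp ((\<psi> i b \<bullet> \<theta>) / \<tau>))" by (intro sum_pos) auto
  then show ?thesis by (simp add: policy_def ln_div)
qed

lemma GDERIV_unique:
  assumes "GDERIV f x :> D" "GDERIV f x :> E"
  shows "D = E"
proof -
  have eq: "(\<lambda>h. h \<bullet> D) = (\<lambda>h. h \<bullet> E)"
    using assms unfolding gderiv_def by (rule has_derivative_unique)
  have "(D - E) \<bullet> (D - E) = 0"
    using fun_cong[OF eq, of "D - E"] by (simp add: inner_diff_right)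
  then show ?thesis by simp
qed

lemma grad_eqI: "GDERIV f x :> D \<Longrightarrow> grad f x = D"
  unfolding grad_def by (rule the_equality, assumption) (rule GDERIV_unique)

text \<open>The log-policy is a linear term minus the logarithm of the partition function, whose
  gradient is the policy average of the features. The explicit form removes the description operator
  in \<open>grad\<close> from the Lipschitz estimates.\<close>

lemma grad_ln_policy:
  "grad (\<lambda>\<theta>'. ln (policy \<tau> \<psi> \<theta>' i a)) \<theta> = (1 / \<tau>) *\<^sub>R (\<psi> i a - (\<Sum>b\<in>UNIV. policy \<tau> \<psi> \<theta> i b *\<^sub>R \<psi> i b))"
    (is "_ = ?D")
proof -
  let ?s = "\<Sum>b\<in>UNIV. exp ((\<psi> i b \<bullet> \<theta>) / \<tau>)"
  have s: "0 < ?s" by (intro sum_pos) auto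
  have "((\<lambda>\<theta>'. ln (policy \<tau> \<psi> \<theta>' i a)) has_derivative
      (\<lambda>h. (\<psi> i a \<bullet> h) / \<tau> - (\<Sum>b\<in>UNIV. exp ((\<psi> i b \<bullet> \<theta>) / \<tau>) * ((\<psi> i b \<bullet> h) / \<tau>)) / ?s)) (at \<theta>)"
    unfolding ln_policy using s
    by (auto intro!: derivative_eq_intros simp: divide_inverse mult_ac)
  moreover have "(\<psi> i a \<bullet> h) / \<tau> - (\<Sum>b\<in>UNIV. exp ((\<psi> i b \<bullet> \<theta>) / \<tau>) * ((\<psi> i b \<bullet> h) / \<tau>)) / ?s = h \<bullet> ?D" for h
    by (simp add: policy_def inner_diff_right inner_sum_right sum_divide_distrib diff_divide_distrib
        inner_commute divide_inverse sum_distrib_left right_diff_distrib mult_ac)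
  ultimately have "GDERIV (\<lambda>\<theta>'. ln (policy \<tau> \<psi> \<theta>' i a)) \<theta> :> ?D"
    by (simp add: gderiv_def)
  then show ?thesis by (rule grad_eqI)
qed

text \<open>A rank-one matrix acts through one inner product; in this form the critic drift needs no
  matrix estimates.\<close>

lemma critic_A_mult:
  fixes w :: "real ^ 'm"
  shows "critic_A \<tau> lam_c \<psi> \<phi> \<theta> \<mu> *v w = lam_c *\<^sub>R w +
    (\<Sum>i\<in>UNIV. \<Sum>a\<in>UNIV. (occupation \<tau> \<psi> \<theta> \<mu> i a * (\<phi> i a \<bullet> w)) *\<^sub>R \<phi> i a)"
proof -
  have "linear (\<lambda>B :: real ^ 'm ^ 'm. B *v w)"
    by (intro linearI) (auto simp: matrix_vector_mult_add_rdistrib scaleR_matrix_vector_assoc)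
  then interpret linear "\<lambda>B :: real ^ 'm ^ 'm. B *v w" .
  have "(\<chi> k l. v $ k * v $ l) *v w = (v \<bullet> w) *\<^sub>R v" for v :: "real ^ 'm"
    by (simp add: vec_eq_iff matrix_vector_mult_def inner_vec_def sum_distrib_left sum_distrib_right mult_ac)
  then show ?thesis
    by (simp add: critic_A_def add sum scale)
qed

section \<open>Bounds on the critic drift\<close>

definition M_r :: "('n::finite \<Rightarrow> 'k::finite \<Rightarrow> real) \<Rightarrow> real" where
  "M_r r = Max (range (\<lambda>(i, a). \<bar>r i a\<bar>))"

definition M_\<phi> :: "('n::finite \<Rightarrow> 'k::finite \<Rightarrow> real ^ 'm) \<Rightarrow> real" where
  "M_\<phi> \<phi> = Max (range (\<lambda>(i, a). norm (\<phi> i a)))"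

lemma abs_le_M_r: "\<bar>r i a\<bar> \<le> M_r r"
  unfolding M_r_def by (rule Max_ge) (auto intro!: image_eqI[of _ _ "(i, a)"])

lemma norm_le_M_\<phi>: "norm (\<phi> i a) \<le> M_\<phi> \<phi>"
  unfolding M_\<phi>_def by (rule Max_ge) (auto intro!: image_eqI[of _ _ "(i, a)"])

lemma radius_w_eq: "radius_w lam_c r \<phi> = max 1 (2 * (M_r r * M_\<phi> \<phi>) / lam_c)"
  by (simp add: radius_w_def M_r_def M_\<phi>_def)

lemma occupation_nonneg: "\<mu> \<in> simplex_S \<Longrightarrow> 0 \<le> occupation \<tau> \<psi> \<theta> \<mu> i a"
  by (simp add: occupation_def simplex_S_def policy_pos less_imp_le)

text \<open>The occupation weights form a probability distribution, so the vector is an average of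
  terms of norm at most \<open>M_r r * M_\<phi> \<phi>\<close>.\<close>

lemma norm_critic_b_le:
  assumes \<mu>: "\<mu> \<in> simplex_S"
  shows "norm (critic_b \<tau> r \<psi> \<phi> \<theta> \<mu>) \<le> M_r r * M_\<phi> \<phi>"
proof -
  have "norm (critic_b \<tau> r \<psi> \<phi> \<theta> \<mu>) \<le> (\<Sum>i\<in>UNIV. \<Sum>a\<in>UNIV. norm ((occupation \<tau> \<psi> \<theta> \<mu> i a * r i a) *\<^sub>R \<phi> i a))"
    unfolding critic_b_def by (intro order_trans[OF norm_sum] sum_mono order_refl)
  also have "\<dots> \<le> (\<Sum>i\<in>UNIV. \<Sum>a\<in>UNIV. occupation \<tau> \<psi> \<theta> \<mu> i a * (M_r r * M_\<phi> \<phi>))"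
  proof (intro sum_mono)
    fix i a
    have "\<bar>r i a\<bar> * norm (\<phi> i a) \<le> M_r r * M_\<phi> \<phi>"
      using abs_le_M_r[of r i a] norm_le_M_\<phi>[of \<phi> i a]
      by (intro mult_mono) auto
    then show "norm ((occupation \<tau> \<psi> \<theta> \<mu> i a * r i a) *\<^sub>R \<phi> i a) \<le> occupation \<tau> \<psi> \<theta> \<mu> i a * (M_r r * M_\<phi> \<phi>)"
      using occupation_nonneg[OF \<mu>, of \<tau> \<psi> \<theta> i a] by (simp add: abs_mult mult.assoc mult_left_mono)
  qed
  also have "\<dots> = M_r r * M_\<phi> \<phi>"
    using \<mu> by (simp add: occupation_def sum_policy simplex_S_def flip: sum_distrib_left sum_distrib_right)
  finally show ?thesis .
qed

text \<open>The factor \<open>s\<close> accounts for truncation, where \<open>A\<close> is applied to the radial projection of \<open>w\<close>.\<close>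

lemma inner_critic_drift_le:
  assumes \<mu>: "\<mu> \<in> simplex_S" and s: "0 \<le> s"
  shows "w \<bullet> (critic_b \<tau> r \<psi> \<phi> \<theta> \<mu> - critic_A \<tau> lam_c \<psi> \<phi> \<theta> \<mu> *v (s *\<^sub>R w))
    \<le> norm w * (M_r r * M_\<phi> \<phi>) - lam_c * s * (norm w)\<^sup>2"
proof -
  have "w \<bullet> critic_b \<tau> r \<psi> \<phi> \<theta> \<mu> \<le> norm w * (M_r r * M_\<phi> \<phi>)"
    by (rule order_trans[OF norm_cauchy_schwarz mult_left_mono[OF norm_critic_b_le[OF \<mu>]]]) simp
  moreover have "w \<bullet> (critic_A \<tau> lam_c \<psi> \<phi> \<theta> \<mu> *v (s *\<^sub>R w)) = lam_c * s * (norm w)\<^sup>2 +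
      (\<Sum>i\<in>UNIV. \<Sum>a\<in>UNIV. occupation \<tau> \<psi> \<theta> \<mu> i a * s * (\<phi> i a \<bullet> w)\<^sup>2)"
    unfolding critic_A_mult
    by (simp add: inner_add_right inner_sum_right dot_square_norm power2_eq_square inner_commute mult_ac)
  moreover have "0 \<le> (\<Sum>i\<in>UNIV. \<Sum>a\<in>UNIV. occupation \<tau> \<psi> \<theta> \<mu> i a * s * (\<phi> i a \<bullet> w)\<^sup>2)"
    using occupation_nonneg[OF \<mu>] s by (intro sum_nonneg mult_nonneg_nonneg) auto
  ultimately show ?thesis by (simp add: inner_diff_right)
qed

lemma actor_G_component:
  "actor_G R \<tau> r \<psi> \<phi> \<theta> w \<mu> $ j = (R\<^sup>2 - (\<theta> $ j)\<^sup>2) * actor_Gtilde \<tau> r \<psi> \<phi> \<theta> w \<mu> $ j"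
proof -
  have "(if P then x else 0) * y = (if P then x * y else 0)" for P and x y :: real by simp
  then show ?thesis by (simp add: actor_G_def diag_D_def matrix_vector_mult_def)
qed

lemma bounded_actor_box: "bounded (actor_box R)"
  using compact_actor_box by (rule compact_imp_bounded)

locale reduced_system = mixing_generators "actor_box R" Q
  for R :: real and Q :: "real ^ 'd \<Rightarrow> real ^ 'n ^ 'n" +
  fixes \<tau> lam_c :: real
    and r :: "'n \<Rightarrow> 'k::finite \<Rightarrow> real"
    and \<psi> :: "'n \<Rightarrow> 'k \<Rightarrow> real ^ 'd"
    and \<phi> :: "'n \<Rightarrow> 'k \<Rightarrow> real ^ 'm"
  assumes R_pos: "0 < R" and lam_pos: "0 < lam_c"
begin

abbreviation V :: "(real ^ 'd) \<times> (real ^ 'm) \<Rightarrow> (real ^ 'd) \<times> (real ^ 'm)" where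
  "V \<equiv> reduced_field R \<tau> lam_c r \<psi> \<phi> Q"

abbreviation tube :: "real \<Rightarrow> ((real ^ 'd) \<times> (real ^ 'm)) set" where
  "tube \<rho> \<equiv> actor_box R \<times> cball 0 \<rho>"

lemma V_simp: "V (\<theta>, w) = (actor_G R \<tau> r \<psi> \<phi> \<theta> w (invariant_law Q \<theta>),
    critic_b \<tau> r \<psi> \<phi> \<theta> (invariant_law Q \<theta>) - critic_A \<tau> lam_c \<psi> \<phi> \<theta> (invariant_law Q \<theta>) *v w)"
  by (simp add: reduced_field_def Let_def)

text \<open>On a tube every ingredient is bounded, so the field is assembled by the closure rules;
  the delicate ingredient is the logarithm, whose argument must stay away from 0.\<close>

lemma tube_lipschitz: "\<exists>L. L-lipschitz_on (tube \<rho>) V"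
proof -
  let ?bl = "bounded_lipschitz_on (tube \<rho>)"
  have bdd: "bounded (tube \<rho>)"
    by (intro bounded_Times bounded_actor_box bounded_cball)
  have fst: "?bl (\<lambda>x. fst x)" and snd: "?bl (\<lambda>x. snd x)"
    by (rule bounded_lipschitz_on_lipschitz[where L = 1, OF lipschitz_onI bdd];
        simp add: dist_fst_le dist_snd_le)+
  obtain L where L: "L-lipschitz_on (actor_box R) (invariant_law Q)"
    using invariant_law_lipschitz by blast
  have "(L * 1)-lipschitz_on (tube \<rho>) (invariant_law Q \<circ> fst)"
    by (rule lipschitz_on_compose[OF lipschitz_onI])
       (use lipschitz_on_nonneg[OF L] in \<open>auto simp: dist_fst_le intro: lipschitz_on_subset[OF L]\<close>)
  then have law: "?bl (\<lambda>x. invariant_law Q (fst x))"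
    using bounded_lipschitz_on_lipschitz[OF _ bdd] by (auto simp: o_def)
  have law_i: "?bl (\<lambda>x. invariant_law Q (fst x) $ i)" for i
    using law by (rule bounded_lipschitz_on_bounded_linear[OF bounded_linear_vec_nth])
  have fst_j: "?bl (\<lambda>x. fst x $ j)" for j
    using fst by (rule bounded_lipschitz_on_bounded_linear[OF bounded_linear_vec_nth])
  have logit: "?bl (\<lambda>x. (\<psi> i a \<bullet> fst x) / \<tau>)" for i a
    unfolding divide_inverse by (intro bounded_lipschitz_on_intros fst)
  have sum_exp: "?bl (\<lambda>x. \<Sum>b\<in>UNIV. exp ((\<psi> i b \<bullet> fst x) / \<tau>))" for i
    by (intro bounded_lipschitz_on_intros bounded_lipschitz_on_exp logit)
  \<comment> \<open>The exponential of one arbitrary action already bounds the sum from below, and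
    its exponent is bounded on the tube.\<close>
  have lower: "\<exists>c>0. \<forall>x\<in>tube \<rho>. c \<le> (\<Sum>b\<in>UNIV. exp ((\<psi> i b \<bullet> fst x) / \<tau>))" for i
  proof -
    fix a :: 'k
    obtain B L where B: "0 \<le> B" "0 \<le> L" "\<And>x. x \<in> tube \<rho> \<Longrightarrow> norm ((\<psi> i a \<bullet> fst x) / \<tau>) \<le> B"
      "\<And>x y. x \<in> tube \<rho> \<Longrightarrow> y \<in> tube \<rho> \<Longrightarrow> norm ((\<psi> i a \<bullet> fst x) / \<tau> - (\<psi> i a \<bullet> fst y) / \<tau>) \<le> L * dist x y"
      by (rule bounded_lipschitz_onE[OF logit]) (rule that; blast)
    have "exp (- B) \<le> (\<Sum>b\<in>UNIV. exp ((\<psi> i b \<bullet> fst x) / \<tau>))" if "x \<in> tube \<rho>" for x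
    proof -
      have "- B \<le> (\<psi> i a \<bullet> fst x) / \<tau>" using B(3)[OF that] unfolding real_norm_def by linarith
      then have "exp (- B) \<le> exp ((\<psi> i a \<bullet> fst x) / \<tau>)" by simp
      also have "\<dots> \<le> (\<Sum>b\<in>UNIV. exp ((\<psi> i b \<bullet> fst x) / \<tau>))"
        by (intro member_le_sum) auto
      finally show ?thesis .
    qed
    then show "\<exists>c>0. \<forall>x\<in>tube \<rho>. c \<le> (\<Sum>b\<in>UNIV. exp ((\<psi> i b \<bullet> fst x) / \<tau>))"
      by (intro exI[of _ "exp (- B)"]) auto
  qed
  have log_policy: "?bl (\<lambda>x. ln (policy \<tau> \<psi> (fst x) i a))" for i a
  proof -
    obtain c where c: "0 < c" "\<And>x. x \<in> tube \<rho> \<Longrightarrow> c \<le> (\<Sum>b\<in>UNIV. exp ((\<psi> i b \<bullet> fst x) / \<tau>))"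
      using lower[of i] by blast
    show ?thesis
      unfolding ln_policy by (intro bounded_lipschitz_on_diff logit bounded_lipschitz_on_ln[OF sum_exp c])
  qed
  \<comment> \<open>Recovering the policy from its logarithm avoids a separate rule for
    quotients.\<close>
  then have "?bl (\<lambda>x. exp (ln (policy \<tau> \<psi> (fst x) i a)))" for i a
    by (rule bounded_lipschitz_on_exp)
  then have policy: "?bl (\<lambda>x. policy \<tau> \<psi> (fst x) i a)" for i a
    by (simp add: policy_pos)
  have occ: "?bl (\<lambda>x. occupation \<tau> \<psi> (fst x) (invariant_law Q (fst x)) i a)" for i a
    unfolding occupation_def by (intro bounded_lipschitz_on_intros law_i policy)
  have "?bl (\<lambda>x. actor_Gtilde \<tau> r \<psi> \<phi> (fst x) (snd x) (invariant_law Q (fst x)))"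
    unfolding actor_Gtilde_def grad_ln_policy
    by (intro bounded_lipschitz_on_intros occ policy log_policy snd)
  then have Gtilde: "?bl (\<lambda>x. actor_Gtilde \<tau> r \<psi> \<phi> (fst x) (snd x) (invariant_law Q (fst x)) $ j)" for j
    by (rule bounded_lipschitz_on_bounded_linear[OF bounded_linear_vec_nth])
  have G: "?bl (\<lambda>x. actor_G R \<tau> r \<psi> \<phi> (fst x) (snd x) (invariant_law Q (fst x)))"
    by (rule bounded_lipschitz_on_vec)
       (unfold actor_G_component power2_eq_square, intro bounded_lipschitz_on_intros fst_j Gtilde)
  have "?bl (\<lambda>x. critic_b \<tau> r \<psi> \<phi> (fst x) (invariant_law Q (fst x))
      - critic_A \<tau> lam_c \<psi> \<phi> (fst x) (invariant_law Q (fst x)) *v snd x)"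
    unfolding critic_b_def critic_A_mult
    by (intro bounded_lipschitz_on_intros occ snd)
  with G have "?bl (\<lambda>x. V (fst x, snd x))"
    unfolding V_simp by (rule bounded_lipschitz_on_Pair)
  then show ?thesis by (simp add: bounded_lipschitz_on_def)
qed

end

section \<open>Truncation of the field and solutions confined to a tube\<close>

definition box_projection :: "real \<Rightarrow> real ^ 'd \<Rightarrow> real ^ 'd" where
  "box_projection R \<theta> = (\<chi> j. max (- R) (min R (\<theta> $ j)))"

lemma box_projection_mem: "0 < R \<Longrightarrow> box_projection R \<theta> \<in> actor_box R"
  by (auto simp: box_projection_def actor_box_def)

lemma box_projection_id: "\<theta> \<in> actor_box R \<Longrightarrow> box_projection R \<theta> = \<theta>"
  by (auto simp: box_projection_def actor_box_def vec_eq_iff max_def min_def intro: antisym)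

lemma dist_box_projection_le: "dist (box_projection R \<theta>) (box_projection R \<theta>') \<le> dist \<theta> \<theta>'"
  unfolding dist_norm
  by (rule norm_le_componentwise_cart) (auto simp: box_projection_def)

text \<open>Outside the ball the projection is a positive multiple of \<open>w\<close>, which is the
  form that \<open>inner_critic_drift_le\<close> accepts with
  \<open>s = \<rho> / norm w\<close>.\<close>

lemma closest_point_cball_eq:
  fixes w :: "'a::euclidean_space"
  assumes "0 < \<rho>" "\<rho> \<le> norm w"
  shows "closest_point (cball 0 \<rho>) w = (\<rho> / norm w) *\<^sub>R w"
proof (rule closest_point_unique[symmetric])
  show "\<forall>z\<in>cball 0 \<rho>. dist w ((\<rho> / norm w) *\<^sub>R w) \<le> dist w z"
  proof
    fix z :: 'a assume "z \<in> cball 0 \<rho>"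
    have "0 < norm w" using assms by linarith
    have "w - (\<rho> / norm w) *\<^sub>R w = (1 - \<rho> / norm w) *\<^sub>R w" by (simp add: scaleR_left_diff_distrib)
    then have "dist w ((\<rho> / norm w) *\<^sub>R w) = \<bar>1 - \<rho> / norm w\<bar> * norm w"
      by (simp add: dist_norm)
    also have "\<dots> = norm w - \<rho>"
      using assms \<open>0 < norm w\<close> by (simp add: abs_of_nonneg field_simps)
    also have "\<dots> \<le> norm w - norm z" using \<open>z \<in> cball 0 \<rho>\<close> by simp
    also have "\<dots> \<le> dist w z" by (simp add: dist_norm norm_triangle_ineq2)
    finally show "dist w ((\<rho> / norm w) *\<^sub>R w) \<le> dist w z" .
  qed
qed (use assms in \<open>auto simp: norm_scaleR\<close>)

lemma has_vector_derivative_fst: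
  "(f has_vector_derivative f') F \<Longrightarrow> ((\<lambda>t. fst (f t)) has_vector_derivative fst f') F"
  by (rule bounded_linear.has_vector_derivative[OF bounded_linear_fst])

lemma has_vector_derivative_snd:
  "(f has_vector_derivative f') F \<Longrightarrow> ((\<lambda>t. snd (f t)) has_vector_derivative snd f') F"
  by (rule bounded_linear.has_vector_derivative[OF bounded_linear_snd])

lemma has_real_derivative_vec_nth:
  fixes f :: "real \<Rightarrow> real ^ 'n"
  shows "(f has_vector_derivative f') F \<Longrightarrow> ((\<lambda>t. f t $ j) has_real_derivative f' $ j) F"
  unfolding has_real_derivative_iff_has_vector_derivative
  by (rule bounded_linear.has_vector_derivative[OF bounded_linear_vec_nth])

lemma has_real_derivative_norm_power2:
  fixes f :: "real \<Rightarrow> 'a::real_inner"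
  assumes "(f has_vector_derivative f') (at t within S)"
  shows "((\<lambda>t. (norm (f t))\<^sup>2) has_real_derivative 2 * (f t \<bullet> f')) (at t within S)"
proof -
  have "((\<lambda>t. f t \<bullet> f t) has_vector_derivative f t \<bullet> f' + f' \<bullet> f t) (at t within S)"
    by (rule bounded_bilinear.has_vector_derivative[OF bounded_bilinear_inner assms assms])
  then show ?thesis
    by (simp add: has_real_derivative_iff_has_vector_derivative power2_norm_eq_inner inner_commute)
qed

context reduced_system
begin

lemma radius_w_bounds: "1 \<le> radius_w lam_c r \<phi>" "M_r r * M_\<phi> \<phi> \<le> lam_c * radius_w lam_c r \<phi> / 2"
proof -
  show "1 \<le> radius_w lam_c r \<phi>" by (simp add: radius_w_eq)
  have "2 * (M_r r * M_\<phi> \<phi>) / lam_c \<le> radius_w lam_c r \<phi>" by (simp add: radius_w_eq)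
  then show "M_r r * M_\<phi> \<phi> \<le> lam_c * radius_w lam_c r \<phi> / 2"
    using lam_pos by (simp add: field_simps)
qed

text \<open>Composing \<open>V\<close> with the projection to \<open>tube \<rho>\<close> makes it globally Lipschitz. The solutions of the
  truncated equation cannot leave the tube: beyond a face of the box the factor \<open>D\<close> vanishes, and
  outside the ball the critic drift points inward.\<close>

lemma tube_solution:
  assumes \<rho>: "radius_w lam_c r \<phi> \<le> \<rho>" and z: "z \<in> tube \<rho>"
  shows "\<exists>y. is_solution (space_Y R) V z y \<and> y ` {0..} \<subseteq> tube \<rho>"
proof -
  have \<rho>1: "1 \<le> \<rho>" using \<rho> radius_w_bounds(1) by simp
  define P where "P x = (box_projection R (fst x), closest_point (cball 0 \<rho>) (snd x))" for x :: "(real ^ 'd) \<times> (real ^ 'm)"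
  have cball: "convex (cball (0 :: real ^ 'm) \<rho>)" "closed (cball (0 :: real ^ 'm) \<rho>)" "cball (0 :: real ^ 'm) \<rho> \<noteq> {}"
    using \<rho>1 by auto
  have P_mem: "P x \<in> tube \<rho>" for x
    using closest_point_in_set[OF cball(2,3), of "snd x"] box_projection_mem[OF R_pos] by (simp add: P_def)
  have P_id: "P x = x" if "x \<in> tube \<rho>" for x
    using that by (auto simp: P_def box_projection_id closest_point_self)
  have P_lip: "1-lipschitz_on UNIV P"
  proof (rule lipschitz_onI)
    fix x y :: "(real ^ 'd) \<times> (real ^ 'm)"
    have "dist (P x) (P y) \<le> sqrt ((dist (fst x) (fst y))\<^sup>2 + (dist (snd x) (snd y))\<^sup>2)"
      unfolding P_def dist_Pair_Pair
      by (intro real_sqrt_le_mono add_mono power_mono dist_box_projection_le closest_point_lipschitz cball) auto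
    then show "dist (P x) (P y) \<le> 1 * dist x y" by (simp add: dist_prod_def)
  qed simp
  obtain L where L: "L-lipschitz_on (tube \<rho>) V" using tube_lipschitz by blast
  have "(L * 1)-lipschitz_on UNIV (V \<circ> P)"
    by (rule lipschitz_on_compose[OF P_lip lipschitz_on_subset[OF L]]) (rule image_subsetI, rule P_mem)
  then obtain y where y: "y 0 = z" "\<And>t. 0 \<le> t \<Longrightarrow> (y has_vector_derivative V (P (y t))) (at t within {0..})"
    using global_lipschitz_solution_exists[of "L * 1" "V \<circ> P" z] by auto
  define \<theta> w where "\<theta> t = fst (y t)" and "w t = snd (y t)" for t
  define \<theta>P wP where "\<theta>P t = box_projection R (\<theta> t)" and "wP t = closest_point (cball 0 \<rho>) (w t)" for t
  \<comment> \<open>The law is taken at the projected parameter: it is known to lie in the simplex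
    only over the box, and the solution is not yet known to stay there.\<close>
  define \<mu> where "\<mu> t = invariant_law Q (\<theta>P t)" for t
  have \<mu>: "\<mu> t \<in> simplex_S" for t
    unfolding \<mu>_def \<theta>P_def by (intro invariant_law_mem box_projection_mem R_pos)
  have y_deriv: "(y has_vector_derivative V (\<theta>P t, wP t)) (at t within {0..T})" if "t \<in> {0..T}" for t T
    using y(2)[of t] that
    by (auto simp: P_def \<theta>P_def wP_def \<theta>_def w_def intro: has_vector_derivative_within_subset)
  have \<theta>_deriv: "((\<lambda>t. \<theta> t $ j) has_real_derivative
      (R\<^sup>2 - (\<theta>P t $ j)\<^sup>2) * actor_Gtilde \<tau> r \<psi> \<phi> (\<theta>P t) (wP t) (\<mu> t) $ j) (at t within {0..T})"
    if "t \<in> {0..T}" for t j T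
    using has_real_derivative_vec_nth[OF has_vector_derivative_fst[OF y_deriv[OF that]]]
    by (simp add: V_simp \<theta>_def \<mu>_def actor_G_component)
  have w_deriv: "((\<lambda>t. (norm (w t))\<^sup>2) has_real_derivative
      2 * (w t \<bullet> (critic_b \<tau> r \<psi> \<phi> (\<theta>P t) (\<mu> t) - critic_A \<tau> lam_c \<psi> \<phi> (\<theta>P t) (\<mu> t) *v wP t))) (at t within {0..T})"
    if "t \<in> {0..T}" for t T
    using has_real_derivative_norm_power2[OF has_vector_derivative_snd[OF y_deriv[OF that]]]
    by (simp add: V_simp w_def \<mu>_def)
  have start: "\<theta> 0 \<in> actor_box R" "norm (w 0) \<le> \<rho>"
    using z by (auto simp: \<theta>_def w_def y(1))
  have "\<theta> t $ j \<le> R" if "0 \<le> t" for t j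
  proof (rule stays_below[where T = t, OF \<theta>_deriv])
    show "\<theta> 0 $ j \<le> R" using start(1) by (simp add: actor_box_def)
    fix s assume "R < \<theta> s $ j"
    then have "\<theta>P s $ j = R" using R_pos by (simp add: \<theta>P_def box_projection_def)
    then show "(R\<^sup>2 - (\<theta>P s $ j)\<^sup>2) * actor_Gtilde \<tau> r \<psi> \<phi> (\<theta>P s) (wP s) (\<mu> s) $ j \<le> 0" by simp
  qed (use that in auto)
  moreover have "- \<theta> t $ j \<le> R" if "0 \<le> t" for t j
  proof (rule stays_below[where T = t, OF DERIV_minus[OF \<theta>_deriv]])
    show "- \<theta> 0 $ j \<le> R" using start(1) by (simp add: actor_box_def minus_le_iff)
    fix s assume "R < - \<theta> s $ j"
    then have "\<theta>P s $ j = - R" using R_pos by (simp add: \<theta>P_def box_projection_def)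
    then show "- ((R\<^sup>2 - (\<theta>P s $ j)\<^sup>2) * actor_Gtilde \<tau> r \<psi> \<phi> (\<theta>P s) (wP s) (\<mu> s) $ j) \<le> 0" by simp
  qed (use that in auto)
  ultimately have \<theta>_mem: "\<theta> t \<in> actor_box R" if "0 \<le> t" for t
    using that by (auto simp: actor_box_def minus_le_iff)
  \<comment> \<open>The barrier lemma is applied to the square because the norm itself need not be
    differentiable where \<open>w\<close> vanishes.\<close>
  have "(norm (w t))\<^sup>2 \<le> \<rho>\<^sup>2" if "0 \<le> t" for t
  proof (rule stays_below[where T = t, OF w_deriv])
    show "(norm (w 0))\<^sup>2 \<le> \<rho>\<^sup>2" using start(2) by (intro power_mono) auto
    fix s assume "\<rho>\<^sup>2 < (norm (w s))\<^sup>2"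
    then have ws: "\<rho> < norm (w s)" by (rule power_less_imp_less_base) simp
    then have wP: "wP s = (\<rho> / norm (w s)) *\<^sub>R w s"
      unfolding wP_def using \<rho>1 by (intro closest_point_cball_eq) auto
    have "w s \<bullet> (critic_b \<tau> r \<psi> \<phi> (\<theta>P s) (\<mu> s) - critic_A \<tau> lam_c \<psi> \<phi> (\<theta>P s) (\<mu> s) *v wP s)
        \<le> norm (w s) * (M_r r * M_\<phi> \<phi>) - lam_c * (\<rho> / norm (w s)) * (norm (w s))\<^sup>2"
      unfolding wP using \<rho>1 by (intro inner_critic_drift_le \<mu>) auto
    also have "\<dots> = norm (w s) * (M_r r * M_\<phi> \<phi> - lam_c * \<rho>)"
      using ws \<rho>1 by (simp add: field_simps power2_eq_square)
    also have "\<dots> \<le> 0"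
    proof (rule mult_nonneg_nonpos)
      have "lam_c * radius_w lam_c r \<phi> \<le> lam_c * \<rho>"
        using \<rho> lam_pos by (intro mult_left_mono) auto
      moreover have "0 \<le> lam_c * radius_w lam_c r \<phi>"
        using lam_pos radius_w_bounds(1) by simp
      ultimately show "M_r r * M_\<phi> \<phi> - lam_c * \<rho> \<le> 0"
        using radius_w_bounds(2) by linarith
    qed simp
    finally show "2 * (w s \<bullet> (critic_b \<tau> r \<psi> \<phi> (\<theta>P s) (\<mu> s) - critic_A \<tau> lam_c \<psi> \<phi> (\<theta>P s) (\<mu> s) *v wP s)) \<le> 0"
      by simp
  qed (use that in auto)
  then have "norm (w t) \<le> \<rho>" if "0 \<le> t" for t
    using that \<rho>1 power2_le_imp_le[of "norm (w t)" \<rho>] by simp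
  with \<theta>_mem have y_mem: "y t \<in> tube \<rho>" if "0 \<le> t" for t
    using that by (simp add: \<theta>_def w_def mem_Times_iff)
  have "is_solution (space_Y R) V z (restrict y {0..})"
    unfolding is_solution_def
  proof (intro conjI allI impI)
    show "restrict y {0..} \<in> {0..} \<rightarrow>\<^sub>E space_Y R"
      using y_mem by (auto simp: space_Y_def mem_Times_iff)
    show "restrict y {0..} 0 = z" using y(1) by simp
    fix t :: real assume t: "0 \<le> t"
    \<comment> \<open>Inside the tube the projection is the identity, so the truncated equation and
      the original one coincide along \<open>y\<close>.\<close>
    have "(y has_vector_derivative V (restrict y {0..} t)) (at t within {0..})"
      using y(2)[OF t] P_id[OF y_mem[OF t]] t by simp
    then show "(restrict y {0..} has_vector_derivative V (restrict y {0..} t)) (at t within {0..})"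
      by (rule has_vector_derivative_transform[rotated 2]) (use t in auto)
  qed
  moreover have "restrict y {0..} ` {0..} \<subseteq> tube \<rho>"
    using y_mem by (intro image_subsetI) simp
  ultimately show ?thesis by blast
qed

lemma bounded_subset_tube:
  assumes "bounded B" "B \<subseteq> space_Y R"
  obtains \<rho> where "radius_w lam_c r \<phi> \<le> \<rho>" "B \<subseteq> tube \<rho>"
proof -
  obtain C where C: "\<And>x. x \<in> B \<Longrightarrow> norm x \<le> C" using assms(1) bounded_iff by metis
  have "norm (snd x) \<le> C" if "x \<in> B" for x
    using C[OF that] norm_snd_le[where x = "fst x" and y = "snd x"] by simp
  then have "B \<subseteq> tube (max C (radius_w lam_c r \<phi>))"
    using assms(2) by (force simp: space_Y_def)
  then show thesis by (intro that[of "max C (radius_w lam_c r \<phi>)"]) auto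
qed

text \<open>The tubes of radius at least \<open>radius_w\<close> are the required enclosures: every
  bounded set fits into one, and it contains the solutions that start in it.\<close>

sublocale lipschitz_flow "space_Y R" V
proof
  fix B :: "((real ^ 'd) \<times> (real ^ 'm)) set" assume "bounded B" "B \<subseteq> space_Y R"
  then obtain \<rho> where \<rho>: "radius_w lam_c r \<phi> \<le> \<rho>" "B \<subseteq> tube \<rho>" by (rule bounded_subset_tube)
  obtain L where "L-lipschitz_on (tube \<rho>) V" using tube_lipschitz by blast
  moreover have "bounded (tube \<rho>)" "tube \<rho> \<subseteq> space_Y R"
    by (auto simp: space_Y_def intro: bounded_Times bounded_actor_box)
  ultimately show "\<exists>K L. bounded K \<and> B \<subseteq> K \<and> K \<subseteq> space_Y R \<and> L-lipschitz_on K V \<and>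
      (\<forall>z\<in>K. \<exists>y. is_solution (space_Y R) V z y \<and> y ` {0..} \<subseteq> K)"
    using \<rho> tube_solution[OF \<rho>(1)] by (intro exI[of _ "tube \<rho>"] exI[of _ L]) blast
qed

lemma flow_tube:
  assumes "radius_w lam_c r \<phi> \<le> \<rho>" "z \<in> tube \<rho>" "0 \<le> t"
  shows "flow t z \<in> tube \<rho>"
proof -
  obtain y where y: "is_solution (space_Y R) V z y" "y ` {0..} \<subseteq> tube \<rho>"
    using tube_solution[OF assms(1,2)] by blast
  have "y t \<in> tube \<rho>" using assms(3) by (intro subsetD[OF y(2)] imageI) simp
  then show ?thesis by (simp only: flow_eq[OF y(1)])
qed

section \<open>Decay of the critic and absorption\<close>

lemma norm_snd_flow_le:
  fixes z :: "(real ^ 'd) \<times> (real ^ 'm)"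
  assumes z: "z \<in> space_Y R" and t: "0 \<le> t"
  shows "(norm (snd (flow t z)))\<^sup>2 \<le> (radius_w lam_c r \<phi>)\<^sup>2 / 4 + exp (- lam_c * t) * (norm (snd z))\<^sup>2"
proof -
  define q where "q = (radius_w lam_c r \<phi>)\<^sup>2 / 4"
  define \<theta> w where "\<theta> t = fst (flow t z)" and "w t = snd (flow t z)" for t
  define \<mu> where "\<mu> t = invariant_law Q (\<theta> t)" for t
  define w' where "w' t = 2 * (w t \<bullet> (critic_b \<tau> r \<psi> \<phi> (\<theta> t) (\<mu> t) - critic_A \<tau> lam_c \<psi> \<phi> (\<theta> t) (\<mu> t) *v w t))" for t
  have \<mu>: "\<mu> s \<in> simplex_S" if "0 \<le> s" for s
    unfolding \<mu>_def \<theta>_def using flow_mem[OF z that]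
    by (intro invariant_law_mem) (auto simp: space_Y_def mem_Times_iff)
  have flow_deriv: "((\<lambda>s. flow s z) has_vector_derivative V (\<theta> s, w s)) (at s within {0..t})" if "s \<in> {0..t}" for s
    using solution_derivative_interval[OF is_solution_flow[OF z] that] by (simp add: \<theta>_def w_def)
  have w_deriv: "((\<lambda>s. (norm (w s))\<^sup>2) has_real_derivative w' s) (at s within {0..t})" if "s \<in> {0..t}" for s
    using has_real_derivative_norm_power2[OF has_vector_derivative_snd[OF flow_deriv[OF that]]]
    by (simp add: V_simp w_def \<mu>_def w'_def)
  have w'_le: "w' s \<le> - lam_c * ((norm (w s))\<^sup>2 - q)" if "0 \<le> s" for s
  proof -
    have "w' s \<le> 2 * (norm (w s) * (M_r r * M_\<phi> \<phi>) - lam_c * 1 * (norm (w s))\<^sup>2)"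
      unfolding w'_def using inner_critic_drift_le[OF \<mu>[OF that], of 1 "w s" \<tau> r \<psi> \<phi> "\<theta> s" lam_c] by simp
    also have "\<dots> \<le> 2 * (norm (w s) * (lam_c * radius_w lam_c r \<phi> / 2) - lam_c * (norm (w s))\<^sup>2)"
      using mult_left_mono[OF radius_w_bounds(2), of "norm (w s)"] by simp
    \<comment> \<open>Half of the dissipation absorbs the linear term by a square centred at half
      the radius; this is the origin of both the level \<open>q\<close> and the rate
      \<open>lam_c\<close>.\<close>
    also have "\<dots> = - lam_c * ((norm (w s))\<^sup>2 - q) - lam_c * (norm (w s) - radius_w lam_c r \<phi> / 2)\<^sup>2"
      by (simp add: q_def power2_eq_square algebra_simps)
    also have "\<dots> \<le> - lam_c * ((norm (w s))\<^sup>2 - q)"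
      using lam_pos by simp
    finally show ?thesis .
  qed
  \<comment> \<open>With the integrating factor the differential inequality becomes monotonicity,
    which is the barrier lemma at the initial value.\<close>
  have "exp (lam_c * t) * ((norm (w t))\<^sup>2 - q) \<le> exp (lam_c * 0) * ((norm (w 0))\<^sup>2 - q)"
  proof (rule stays_below[where u = "\<lambda>s. exp (lam_c * s) * ((norm (w s))\<^sup>2 - q)" and T = t
        and u' = "\<lambda>s. exp (lam_c * s) * w' s + exp (lam_c * s) * lam_c * ((norm (w s))\<^sup>2 - q)"])
    fix s assume s: "s \<in> {0..t}"
    show "((\<lambda>s. exp (lam_c * s) * ((norm (w s))\<^sup>2 - q)) has_real_derivative
        exp (lam_c * s) * w' s + exp (lam_c * s) * lam_c * ((norm (w s))\<^sup>2 - q)) (at s within {0..t})"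
    proof -
      have "((\<lambda>s. exp (lam_c * s)) has_real_derivative exp (lam_c * s) * lam_c) (at s within {0..t})"
        by (auto intro!: derivative_eq_intros)
      from DERIV_mult[OF this DERIV_diff[OF w_deriv[OF s] DERIV_const[of q]]]
      show ?thesis by (simp add: algebra_simps)
    qed
    have "exp (lam_c * s) * w' s \<le> exp (lam_c * s) * (- lam_c * ((norm (w s))\<^sup>2 - q))"
      using w'_le s by (intro mult_left_mono) auto
    then show "exp (lam_c * s) * w' s + exp (lam_c * s) * lam_c * ((norm (w s))\<^sup>2 - q) \<le> 0"
      by simp
  qed (use t in auto)
  also have "\<dots> \<le> (norm (w 0))\<^sup>2" by (simp add: q_def)
  finally have "(norm (w t))\<^sup>2 - q \<le> exp (- lam_c * t) * (norm (w 0))\<^sup>2"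
    by (simp add: exp_minus field_simps)
  then show ?thesis using flow_0[OF z] by (simp add: q_def w_def)
qed

lemma absorbing_time:
  assumes "bounded B" "B \<subseteq> space_Y R"
  shows "\<exists>T\<ge>0. \<forall>t\<ge>T. flow t ` B \<subseteq> tube (radius_w lam_c r \<phi>)"
proof -
  let ?Rw = "radius_w lam_c r \<phi>"
  obtain \<rho> where \<rho>: "?Rw \<le> \<rho>" "B \<subseteq> tube \<rho>" using bounded_subset_tube[OF assms] .
  have "((\<lambda>t. exp (- (lam_c * t)) * \<rho>\<^sup>2) \<longlongrightarrow> 0 * \<rho>\<^sup>2) at_top"
    using lam_pos by (intro tendsto_mult_right filterlim_compose[OF exp_at_bot]
        filterlim_compose[OF filterlim_uminus_at_bot_at_top] filterlim_tendsto_pos_mult_at_top[OF tendsto_const])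
      (auto intro: filterlim_ident)
  \<comment> \<open>Between the limiting level, a quarter of the squared radius, and the squared
    radius there is a gap of at least 3/4, as the radius is at least 1; the value 1/2 fits into
    it.\<close>
  then have "\<forall>\<^sub>F t in at_top. exp (- (lam_c * t)) * \<rho>\<^sup>2 < 1 / 2"
    by (rule order_tendstoD) simp
  then obtain T where T: "\<And>t. T \<le> t \<Longrightarrow> exp (- lam_c * t) * \<rho>\<^sup>2 < 1 / 2"
    unfolding eventually_at_top_linorder by auto
  have "flow t z \<in> tube ?Rw" if t: "max 0 T \<le> t" and z: "z \<in> B" for t z
  proof -
    have "norm (snd z) \<le> \<rho>" using z \<rho> by auto
    then have "exp (- lam_c * t) * (norm (snd z))\<^sup>2 \<le> exp (- lam_c * t) * \<rho>\<^sup>2"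
      by (intro mult_left_mono power_mono) auto
    moreover have "1 \<le> ?Rw\<^sup>2" using radius_w_bounds(1) by simp
    ultimately have "(norm (snd (flow t z)))\<^sup>2 \<le> ?Rw\<^sup>2"
      using norm_snd_flow_le[OF subsetD[OF assms(2) z], of t] T[of t] t by linarith
    then have "norm (snd (flow t z)) \<le> ?Rw"
      by (rule power2_le_imp_le) (use radius_w_bounds(1) in simp)
    moreover have "fst (flow t z) \<in> actor_box R"
      using flow_mem[of z t] z t assms(2) by (auto simp: space_Y_def mem_Times_iff)
    ultimately show ?thesis by (simp add: mem_Times_iff)
  qed
  then have "\<forall>t\<ge>max 0 T. flow t ` B \<subseteq> tube ?Rw"
    by (intro allI impI image_subsetI)
  then show ?thesis by (intro exI[of _ "max 0 T"]) simp
qed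

end

section \<open>The semiflow and its global attractor in the metric of Y\<close>

context reduced_system
begin

abbreviation K_Y :: "((real ^ 'd) \<times> (real ^ 'm)) set" where
  "K_Y \<equiv> tube (radius_w lam_c r \<phi>)"

abbreviation \<A> :: "((real ^ 'd) \<times> (real ^ 'm)) set" where
  "\<A> \<equiv> omega_limit (space_Y R) dist_Y flow K_Y"

lemma tube_subset_space_Y: "tube \<rho> \<subseteq> space_Y R"
  by (auto simp: space_Y_def)

lemma compact_tube: "compact (tube \<rho>)"
  by (intro compact_Times compact_actor_box compact_cball)

lemma locally_Lipschitz_field: "locally_Lipschitz_in (space_Y R) dist_Y V"
  unfolding locally_Lipschitz_in_def
proof
  interpret Y: Metric_space "space_Y R" dist_Y
    by (rule Metric_space_dist_Y)
  fix z :: "(real ^ 'd) \<times> (real ^ 'm)" assume "z \<in> space_Y R"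
  have "Y.mball z 1 \<subseteq> space_Y R" "bounded (Y.mball z 1)"
    using mbounded_imp_bounded[OF Metric_space_dist_Y dist_le_dist_Y Y.mbounded_mball] by blast+
  then obtain \<rho> where \<rho>: "Y.mball z 1 \<subseteq> tube \<rho>" using bounded_subset_tube by metis
  obtain L where L: "L-lipschitz_on (tube \<rho>) V" using tube_lipschitz by blast
  have "dist_Y (V x) (V y) \<le> 2 * L * dist_Y x y" if "x \<in> Y.mball z 1" "y \<in> Y.mball z 1" for x y
  proof -
    have "dist_Y (V x) (V y) \<le> 2 * dist (V x) (V y)" by (rule dist_Y_le_dist)
    also have "dist (V x) (V y) \<le> L * dist x y"
      using subsetD[OF \<rho> that(1)] subsetD[OF \<rho> that(2)] by (rule lipschitz_onD[OF L])
    also have "\<dots> \<le> L * dist_Y x y"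
      using lipschitz_on_nonneg[OF L] by (intro mult_left_mono dist_le_dist_Y)
    finally show ?thesis by simp
  qed
  then show "\<exists>\<epsilon>>0. \<exists>L. \<forall>x\<in>Y.mball z \<epsilon>. \<forall>y\<in>Y.mball z \<epsilon>. dist_Y (V x) (V y) \<le> L * dist_Y x y"
    by (intro exI[of _ 1] exI[of _ "2 * L"] conjI ballI) auto
qed

lemma generates_flow: "generates_continuous_semiflow (space_Y R) dist_Y V"
  unfolding generates_continuous_semiflow_def
proof (intro conjI ballI allI impI)
  show "\<exists>!y. is_solution (space_Y R) V z y" if "z \<in> space_Y R" for z
    using solution_exists[OF that] solution_unique by blast
  have "(\<lambda>(t, z). flow t z) \<in> {0..} \<times> space_Y R \<rightarrow> space_Y R"
    using flow_mem by auto
  then show "continuous_map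
      (prod_topology (top_of_set {0..}) (Metric_space.mtopology (space_Y R) dist_Y))
      (Metric_space.mtopology (space_Y R) dist_Y) (\<lambda>(t, z). flow t z)"
    using continuous_on_flow by (simp add: mtopology_dist_Y continuous_map_in_subtopology)
qed (simp_all add: flow_0 flow_add)

lemma compactin_K_Y: "compactin (Metric_space.mtopology (space_Y R) dist_Y) K_Y"
  using tube_subset_space_Y compact_tube by (simp add: mtopology_dist_Y compactin_subtopology)

lemma forward_invariant_K_Y: "forward_invariant flow K_Y"
  unfolding forward_invariant_def
  by (intro allI impI image_subsetI flow_tube order_refl)

lemma absorbing_K_Y: "absorbing (space_Y R) dist_Y flow K_Y"
  unfolding absorbing_def
  by (intro allI impI absorbing_time mbounded_imp_bounded[OF Metric_space_dist_Y dist_le_dist_Y])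

lemma K_Y_nonempty: "K_Y \<noteq> {}"
proof -
  have "(0, 0) \<in> K_Y" using R_pos radius_w_bounds(1) by (simp add: actor_box_def)
  then show ?thesis by blast
qed

lemma continuous_on_flow_time: "\<forall>t\<ge>0. continuous_on K_Y (flow t)"
proof (intro allI impI)
  fix t :: real assume t: "0 \<le> t"
  have "continuous_on K_Y (\<lambda>z. (\<lambda>(t, z). flow t z) (t, z))"
    by (rule continuous_on_compose2[OF continuous_on_flow, where f = "Pair t"])
       (use t tube_subset_space_Y in \<open>auto intro!: continuous_intros\<close>)
  then show "continuous_on K_Y (flow t)" by simp
qed

lemma flow_add_K_Y: "\<forall>s\<ge>0. \<forall>t\<ge>0. \<forall>z\<in>K_Y. flow (t + s) z = flow t (flow s z)"
  using flow_add subsetD[OF tube_subset_space_Y] by blast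

lemmas \<A>_facts = omega_limit_attracts[OF continuous_on_flow_time flow_add_K_Y compact_tube K_Y_nonempty
  tube_subset_space_Y forward_invariant_K_Y mtopology_dist_Y]

lemma \<A>_subset_space_Y: "\<A> \<subseteq> space_Y R"
  using \<A>_facts(3) tube_subset_space_Y by (rule order_trans)

text \<open>Two waiting times add up: \<open>T\<close> until \<open>B\<close> has entered
  \<open>K_Y\<close>, then \<open>s\<close> until the flow carries \<open>K_Y\<close> into the open
  neighbourhood of radius \<open>e\<close>.\<close>

lemma \<A>_attracts:
  assumes B: "bounded B" "B \<subseteq> space_Y R" and "0 < e"
  shows "\<exists>T. \<forall>t\<ge>T. \<forall>z\<in>B. \<exists>y\<in>\<A>. dist (flow t z) y < e"
proof -
  have U: "open (\<Union>y\<in>\<A>. ball y e)" "\<A> \<subseteq> (\<Union>y\<in>\<A>. ball y e)"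
    using \<open>0 < e\<close> by auto
  obtain s where s: "0 \<le> s" "\<forall>t\<ge>s. flow t ` K_Y \<subseteq> (\<Union>y\<in>\<A>. ball y e)"
    using \<A>_facts(5)[OF U] by (elim exE conjE)
  obtain T where T: "0 \<le> T" "\<And>t. T \<le> t \<Longrightarrow> flow t ` B \<subseteq> K_Y"
    using absorbing_time[OF B] by blast
  have "\<exists>y\<in>\<A>. dist (flow t z) y < e" if "T + s \<le> t" "z \<in> B" for t z
  proof -
    have "flow t z = flow (t - T) (flow T z)"
      using flow_add[of z T "t - T"] that B T(1) s(1) by auto
    also have "\<dots> \<in> flow (t - T) ` K_Y"
      using T(2)[OF order_refl] that(2) by blast
    also have "\<dots> \<subseteq> (\<Union>y\<in>\<A>. ball y e)"
      using that(1) by (intro s(2)[rule_format]) simp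
    finally show ?thesis by (auto simp: dist_commute)
  qed
  then show ?thesis by blast
qed

lemma global_attractor_\<A>: "global_attractor (space_Y R) dist_Y flow \<A>"
proof (rule global_attractorI[OF Metric_space_dist_Y])
  show "flow t \<in> space_Y R \<rightarrow> space_Y R" if "0 \<le> t" for t
    using flow_mem that by blast
  show "compactin (Metric_space.mtopology (space_Y R) dist_Y) \<A>"
    using \<A>_facts(2) \<A>_subset_space_Y by (simp add: mtopology_dist_Y compactin_subtopology)
  show "\<A> \<noteq> {}" by (rule \<A>_facts(1))
  show "flow t ` \<A> = \<A>" if "0 \<le> t" for t
    using that by (rule \<A>_facts(4))
next
  fix B :: "((real ^ 'd) \<times> (real ^ 'm)) set" and e :: real
  assume "Metric_space.mbounded (space_Y R) dist_Y B" and e: "0 < e"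
  then have B: "bounded B" "B \<subseteq> space_Y R"
    using mbounded_imp_bounded[OF Metric_space_dist_Y dist_le_dist_Y] by blast+
  \<comment> \<open>The halving compensates the factor 2 by which \<open>dist_Y\<close> may exceed
    \<open>dist\<close>.\<close>
  have "0 < e / 2" using e by simp
  from \<A>_attracts[OF B this] obtain T
    where T: "\<And>t z. T \<le> t \<Longrightarrow> z \<in> B \<Longrightarrow> \<exists>y\<in>\<A>. dist (flow t z) y < e / 2" by blast
  have "\<exists>y\<in>\<A>. dist_Y (flow t z) y \<le> e" if tz: "T \<le> t" "z \<in> B" for t z
  proof -
    obtain y where y: "y \<in> \<A>" "dist (flow t z) y < e / 2" using T[OF tz] by blast
    then have "dist_Y (flow t z) y \<le> e" using dist_Y_le_dist[of "flow t z" y] by simp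
    then show ?thesis using y(1) by blast
  qed
  then show "\<exists>T. \<forall>t\<ge>T. \<forall>z\<in>B. \<exists>y\<in>\<A>. dist_Y (flow t z) y \<le> e" by blast
qed

section \<open>Transport of the attractor to X\<close>

abbreviation lift :: "(real ^ 'd) \<times> (real ^ 'm) \<Rightarrow> (real ^ 'd) \<times> (real ^ 'm) \<times> (real ^ 'n)" where
  "lift \<equiv> lift_law (invariant_law Q)"

lemma lift_mem: "y \<in> space_Y R \<Longrightarrow> lift y \<in> space_X R"
  by (auto simp: space_Y_def space_X_def lift_law_def invariant_law_mem)

lemma lift_lipschitz: "\<exists>L. L-lipschitz_on (space_Y R) lift"
proof -
  obtain L where L: "L-lipschitz_on (actor_box R) (invariant_law Q)"
    using invariant_law_lipschitz by blast
  have "dist (lift x) (lift y) \<le> (2 + L) * dist x y" if xy: "x \<in> space_Y R" "y \<in> space_Y R" for x y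
  proof -
    obtain \<theta> w \<theta>' w' where eq: "x = (\<theta>, w)" "y = (\<theta>', w')" by (metis prod.exhaust)
    have \<theta>: "dist \<theta> \<theta>' \<le> dist x y" and w: "dist w w' \<le> dist x y"
      using dist_fst_le[of x y] dist_snd_le[of x y] by (simp_all add: eq)
    have "dist (lift x) (lift y) \<le> dist \<theta> \<theta>' + dist (w, invariant_law Q \<theta>) (w', invariant_law Q \<theta>')"
      unfolding eq lift_law_def prod.case by (rule dist_Pair_le)
    also have "dist (w, invariant_law Q \<theta>) (w', invariant_law Q \<theta>') \<le> dist w w' + dist (invariant_law Q \<theta>) (invariant_law Q \<theta>')"
      by (rule dist_Pair_le)
    also have "dist (invariant_law Q \<theta>) (invariant_law Q \<theta>') \<le> L * dist \<theta> \<theta>'"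
      using xy by (intro lipschitz_onD[OF L]) (auto simp: eq space_Y_def)
    also have "L * dist \<theta> \<theta>' \<le> L * dist x y"
      using \<theta> lipschitz_on_nonneg[OF L] by (rule mult_left_mono)
    finally show ?thesis using \<theta> w by (simp add: algebra_simps)
  qed
  then show ?thesis
    using lipschitz_on_nonneg[OF L] by (intro exI[of _ "2 + L"] lipschitz_onI) auto
qed

lemma compactin_lift_\<A>: "compactin (Metric_space.mtopology (space_X R) dist_X) (lift ` \<A>)"
proof -
  obtain L where "L-lipschitz_on (space_Y R) lift" using lift_lipschitz by blast
  then have "continuous_on \<A> lift"
    using lipschitz_on_continuous_on \<A>_subset_space_Y continuous_on_subset by blast
  then have "compact (lift ` \<A>)" using \<A>_facts(2) by (rule compact_continuous_image)
  then show ?thesis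
    using lift_mem \<A>_subset_space_Y
    by (auto simp: mtopology_dist_X compactin_subtopology)
qed

text \<open>Each map of the family is the lift after the flow after the projection \<open>p\<close>
  that forgets the law. As the family is not the identity at time 0, its attractor is not
  constructed from its own dynamics: invariance and attraction are transported from
  \<open>\<A>\<close> through this factorization.\<close>

lemma global_attractor_lift_\<A>:
  "global_attractor (space_X R) dist_X (lifted_semiflow (invariant_law Q) flow) (lift ` \<A>)"
proof (rule global_attractorI[OF Metric_space_dist_X _ _ compactin_lift_\<A>])
  show "lift ` \<A> \<noteq> {}" using \<A>_facts(1) by simp
  show "lifted_semiflow (invariant_law Q) flow t \<in> space_X R \<rightarrow> space_X R" if t: "0 \<le> t" for t
  proof
    fix x :: "(real ^ 'd) \<times> (real ^ 'm) \<times> (real ^ 'n)" assume "x \<in> space_X R"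
    then obtain \<theta> w \<mu> where x: "x = (\<theta>, w, \<mu>)" "(\<theta>, w) \<in> space_Y R"
      by (auto simp: space_X_def space_Y_def)
    show "lifted_semiflow (invariant_law Q) flow t x \<in> space_X R"
      using lift_mem[OF flow_mem[OF x(2) t]] by (simp add: x(1) lifted_semiflow_def)
  qed
  show "lifted_semiflow (invariant_law Q) flow t ` lift ` \<A> = lift ` \<A>" if t: "0 \<le> t" for t
  proof -
    have "lifted_semiflow (invariant_law Q) flow t (lift y) = lift (flow t y)" for y
      by (cases y) (simp add: lifted_semiflow_def lift_law_def)
    then have "lifted_semiflow (invariant_law Q) flow t ` lift ` \<A> = lift ` flow t ` \<A>"
      by (simp add: image_image)
    then show ?thesis using \<A>_facts(4)[OF t] by simp
  qed
next
  fix B :: "((real ^ 'd) \<times> (real ^ 'm) \<times> (real ^ 'n)) set" and e :: real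
  assume "Metric_space.mbounded (space_X R) dist_X B" and e: "0 < e"
  then have B: "bounded B" "B \<subseteq> space_X R"
    using mbounded_imp_bounded[OF Metric_space_dist_X dist_le_dist_X] by blast+
  define p where "p x = (fst x, fst (snd x))" for x :: "(real ^ 'd) \<times> (real ^ 'm) \<times> (real ^ 'n)"
  have "bounded_linear p"
    unfolding p_def[abs_def]
    by (intro bounded_linear_Pair bounded_linear_fst bounded_linear_fst_comp bounded_linear_snd)
  then have "bounded (p ` B)" by (rule bounded_linear_image[OF B(1)])
  moreover have "p ` B \<subseteq> space_Y R"
    using B(2) by (auto simp: p_def space_X_def space_Y_def)
  ultimately have pB: "bounded (p ` B)" "p ` B \<subseteq> space_Y R" .
  obtain L where L: "L-lipschitz_on (space_Y R) lift" using lift_lipschitz by blast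
  define C where "C = (2 + real CARD('n)) * L"
  have C: "0 \<le> C" using lipschitz_on_nonneg[OF L] by (simp add: C_def)
  \<comment> \<open>\<open>C\<close> combines the Lipschitz constant of the lift with the comparison
    of \<open>dist_X\<close> and \<open>dist\<close>. It is known only to be nonnegative, so 1 is
    added before dividing.\<close>
  have "0 < e / (C + 1)" using e C by simp
  from \<A>_attracts[OF pB this] obtain T
    where T: "\<And>t x. T \<le> t \<Longrightarrow> x \<in> B \<Longrightarrow> \<exists>y\<in>\<A>. dist (flow t (p x)) y < e / (C + 1)" by blast
  have "\<exists>y\<in>lift ` \<A>. dist_X (lifted_semiflow (invariant_law Q) flow t x) y \<le> e"
    if t: "max 0 T \<le> t" and x: "x \<in> B" for t x
  proof -
    have "T \<le> t" "0 \<le> t" using t by simp_all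
    obtain y where y: "y \<in> \<A>" "dist (flow t (p x)) y < e / (C + 1)"
      using T[OF \<open>T \<le> t\<close> x] by blast
    have mem: "flow t (p x) \<in> space_Y R" "y \<in> space_Y R"
      using flow_mem \<open>0 \<le> t\<close> pB(2) x y(1) \<A>_subset_space_Y by blast+
    have "dist_X (lift (flow t (p x))) (lift y) \<le> (2 + real CARD('n)) * dist (lift (flow t (p x))) (lift y)"
      by (rule dist_X_le_dist)
    also have "\<dots> \<le> (2 + real CARD('n)) * (L * dist (flow t (p x)) y)"
      by (intro mult_left_mono lipschitz_onD[OF L mem]) simp
    also have "\<dots> \<le> (C + 1) * dist (flow t (p x)) y"
      by (simp add: C_def algebra_simps)
    also have "\<dots> \<le> e"
      using y(2) C by (simp add: field_simps)
    finally have "dist_X (lift (flow t (p x))) (lift y) \<le> e" .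
    moreover have "lifted_semiflow (invariant_law Q) flow t x = lift (flow t (p x))"
      by (cases x) (simp add: lifted_semiflow_def p_def)
    ultimately show ?thesis using y(1) by auto
  qed
  then show "\<exists>T. \<forall>t\<ge>T. \<forall>x\<in>B. \<exists>y\<in>lift ` \<A>. dist_X (lifted_semiflow (invariant_law Q) flow t x) y \<le> e"
    by blast
qed

end

theorem mainTheorem3:
  fixes R_\<theta> \<tau> lam_c :: real
    and r :: "'n::finite \<Rightarrow> 'k::finite \<Rightarrow> real"
    and \<psi> :: "'n \<Rightarrow> 'k \<Rightarrow> real ^ 'd"
    and \<phi> :: "'n \<Rightarrow> 'k \<Rightarrow> real ^ 'm"
    and Q :: "real ^ 'd \<Rightarrow> real ^ 'n ^ 'n"
  assumes "R_\<theta> > 0" and "\<tau> > 0" and "lam_c > 0"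
    and generator: "\<forall>\<theta>\<in>actor_box R_\<theta>. is_generator (Q \<theta>)"
    and Lipschitz: "\<exists>L_Q>0. \<forall>\<theta>\<in>actor_box R_\<theta>. \<forall>\<theta>'\<in>actor_box R_\<theta>.
      opnorm1 (transpose (Q \<theta>) - transpose (Q \<theta>')) \<le> L_Q * norm (\<theta> - \<theta>')"
    and mixing: "\<exists>C_mix\<ge>1. \<exists>\<gamma>>0. \<forall>\<theta>\<in>actor_box R_\<theta>. \<forall>\<xi>\<in>zero_sum. \<forall>t\<ge>0.
      norm1 (mat_exp (t *\<^sub>R transpose (Q \<theta>)) *v \<xi>) \<le> C_mix * exp (- \<gamma> * t) * norm1 \<xi>"
  shows "let
      X = (space_X R_\<theta> :: ((real ^ 'd) \<times> (real ^ 'm) \<times> (real ^ 'n)) set);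
      Y = (space_Y R_\<theta> :: ((real ^ 'd) \<times> (real ^ 'm)) set);
      V = reduced_field R_\<theta> \<tau> lam_c r \<psi> \<phi> Q;
      S = solution_map Y V;
      K_Y = actor_box R_\<theta> \<times> cball 0 (radius_w lam_c r \<phi>);
      \<A>0 = omega_limit Y dist_Y S K_Y;
      \<A>0_lift = lift_law (invariant_law Q) ` \<A>0;
      \<Gamma>0 = lifted_semiflow (invariant_law Q) S
    in
      (\<forall>\<theta>\<in>actor_box R_\<theta>. \<exists>!\<mu>. \<mu> \<in> simplex_S \<and> transpose (Q \<theta>) *v \<mu> = 0) \<and>
      locally_Lipschitz_in Y dist_Y V \<and>
      generates_continuous_semiflow Y dist_Y V \<and>
      compactin (Metric_space.mtopology Y dist_Y) K_Y \<and>
      forward_invariant S K_Y \<and>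
      absorbing Y dist_Y S K_Y \<and>
      global_attractor Y dist_Y S \<A>0 \<and>
      compactin (Metric_space.mtopology X dist_X) \<A>0_lift \<and>
      global_attractor X dist_X \<Gamma>0 \<A>0_lift"
proof -
  interpret reduced_system R_\<theta> Q \<tau> lam_c r \<psi> \<phi>
  proof
    show "compact (actor_box R_\<theta> :: (real ^ 'd) set)" by (rule compact_actor_box)
    show "is_generator (Q \<theta>)" if "\<theta> \<in> actor_box R_\<theta>" for \<theta>
      using generator that by blast
    show "\<exists>L. \<forall>\<theta>\<in>actor_box R_\<theta>. \<forall>\<theta>'\<in>actor_box R_\<theta>.
        opnorm1 (transpose (Q \<theta>) - transpose (Q \<theta>')) \<le> L * norm (\<theta> - \<theta>')"
      using Lipschitz by (elim exE conjE) (rule exI)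
    show "\<exists>C \<gamma>. 0 < \<gamma> \<and> (\<forall>\<theta>\<in>actor_box R_\<theta>. \<forall>\<xi>\<in>zero_sum. \<forall>t\<ge>0.
        norm1 (mat_exp (t *\<^sub>R transpose (Q \<theta>)) *v \<xi>) \<le> C * exp (- \<gamma> * t) * norm1 \<xi>)"
      using mixing by (elim exE conjE) (intro exI conjI)
  qed fact+
  show ?thesis
    unfolding Let_def
    by (intro conjI ballI invariant_law_ex1 locally_Lipschitz_field generates_flow compactin_K_Y
        forward_invariant_K_Y absorbing_K_Y global_attractor_\<A> compactin_lift_\<A> global_attractor_lift_\<A>)
qed

end
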